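(* Let $K$ be a non-trivial (possibly non-complete) valuation field whose metric completion $\hat K$ is locally compact, and let $X$ be a finite-dimensional vector space over $K$. Then the maps $\hat F:\tau_K(X)\to\sigma_{\hat K}(\hat X)$ and $\hat G:\sigma_{\hat K}(\hat X)\to\tau_K(X)$ are inverse to each other. Moreover, $\hat F$ and $\hat G$ invert the inclusion relation, i.e. $T\subset T'$ implies $\hat F(T')\subset\hat F(T)$ for all $T,T'\in\tau_K(X)$, and $S\subset S'$ implies $\hat G(S')\subset \hat G(S)$ for all $S,S'\in\sigma_{\hat K}(\hat X)$.
   Context: A topology on a set is a family of subsets satisfying the open set axioms (homeomorphic topologies are not identified). A valuation on a (commutative) field $K$ is a function $\nu:K\to\mathbb{R}$ with $\nu(\alpha)\ge 0$; $\nu(\alpha)=0\Leftrightarrow\alpha=0$; $\nu(\alpha\beta)=\nu(\alpha)\nu(\beta)$; $\nu(\alpha+\beta)\le\nu(\alpha)+\nu(\beta)$ for all $\alpha,\beta\in K$. The valuation field $(K,\nu)$ carries the topology of the metric $d_\nu(\alpha,\beta)=\nu(\alpha-\beta)$; it is non-trivial if this topology is not discrete. $\hat K$ denotes the metric completion of $(K,d_\nu)$, a valuation field with the extended operations and the extended valuation $\hat\nu$. For a vector space $Z$ over a Hausdorff topological field $k$, a (possibly non-Hausdorff) topology on $Z$ is compatible if addition $Z\times Z\to Z$ and scalar multiplication $k\times Z\to Z$ are continuous (product topologies on the domains). $\tau_k(Z)$ is the set of all compatible topologies on $Z$, $\sigma_k(Z)$ is the set of all $k$-linear subspaces of $Z$,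 and $T_k^{\max}(Z)$ is the largest element of $\tau_k(Z)$ with respect to inclusion (it exists). $\mathrm{cl}_T[A]$ is the closure of $A$ with respect to $T$. Put $\hat X=\hat K\otimes_K X$ and let $I:X\to\hat X$, $I(x)=1\otimes x$ (injective). For a $\hat K$-subspace $S$ of $\hat X$ let $\pi_S:\hat X\to\hat X/S$ be the quotient map and let $$G(S)=\{\pi_S^{-1}(V)\mid V\subset \hat X/S,\ \pi_S^{-1}(V)\in T_{\hat K}^{\max}(\hat X)\}\in\tau_{\hat K}(\hat X).$$ Define, for $T\in\tau_K(X)$ and $S\in\sigma_{\hat K}(\hat X)$, $$\hat F(T)=\bigcap_{0\in U\in T}\mathrm{cl}_{T_{\hat K}^{\max}(\hat X)}[I(U)],\qquad \hat G(S)=\{I^{-1}(V)\mid V\in G(S)\}.$$ These are a $\hat K$-subspace of $\hat X$ and a compatible topology on $X$, respectively. *)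

theory Defs
  imports "HOL-Analysis.Analysis" "HOL-Library.Poly_Mapping"
    "HOL-Computational_Algebra.Group_Closure"
begin

section \<open>Valuation fields and their completion\<close>

definition valuation :: "('k::field \<Rightarrow> real) \<Rightarrow> bool" where
  "valuation \<nu> \<longleftrightarrow>
     (\<forall>a. 0 \<le> \<nu> a) \<and> (\<forall>a. \<nu> a = 0 \<longleftrightarrow> a = 0) \<and>
     (\<forall>a b. \<nu> (a * b) = \<nu> a * \<nu> b) \<and> (\<forall>a b. \<nu> (a + b) \<le> \<nu> a + \<nu> b)"

definition val_dist :: "('k::field \<Rightarrow> real) \<Rightarrow> 'k \<Rightarrow> 'k \<Rightarrow> real" where
  "val_dist \<nu> a b = \<nu> (a - b)"

lemma valuation_Metric_space:
  assumes "valuation \<nu>" shows "Metric_space UNIV (val_dist \<nu>)"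
proof -
  have nonneg: "\<And>a. 0 \<le> \<nu> a" and zero: "\<And>a. \<nu> a = 0 \<longleftrightarrow> a = 0"
    and mult: "\<And>a b. \<nu> (a * b) = \<nu> a * \<nu> b" and add: "\<And>a b. \<nu> (a + b) \<le> \<nu> a + \<nu> b"
    using assms unfolding valuation_def by auto
  have one: "\<nu> 1 = 1" using mult[of 1 1] zero[of 1] by simp
  have "\<nu> (-1) * \<nu> (-1) = 1" using mult[of "-1" "-1"] one by simp
  then have "(\<nu> (-1))\<^sup>2 = 1" by (simp add: power2_eq_square)
  then have "\<nu> (-1) = 1" using nonneg[of "-1"] by (auto simp: power2_eq_1_iff)
  then have minus: "\<nu> (- a) = \<nu> a" for a using mult[of "-1" a] by simp
  show ?thesis
  proof
    fix x y z :: 'a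
    show "0 \<le> val_dist \<nu> x y" by (simp add: val_dist_def nonneg)
    show "val_dist \<nu> x y = val_dist \<nu> y x"
      using minus[of "x - y"] by (simp add: val_dist_def)
    show "val_dist \<nu> x y = 0 \<longleftrightarrow> x = y" by (simp add: val_dist_def zero)
    show "val_dist \<nu> x z \<le> val_dist \<nu> x y + val_dist \<nu> y z"
      using add[of "x - y" "y - z"] by (simp add: val_dist_def)
  qed
qed

definition val_topology :: "('k::field \<Rightarrow> real) \<Rightarrow> 'k topology" where
  "val_topology \<nu> = Metric_space.mtopology UNIV (val_dist \<nu>)"

definition nontrivial_valuation :: "('k::field \<Rightarrow> real) \<Rightarrow> bool" where
  "nontrivial_valuation \<nu> \<longleftrightarrow> val_topology \<nu> \<noteq> discrete_topology UNIV"

text \<open>\<open>(L, \<mu>)\<close> together with the embedding \<open>\<iota>\<close> is a metric completion of the valuation field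
  \<open>(K, \<nu>)\<close>. This determines \<open>(L, \<mu>, \<iota>)\<close> up to a unique isometric field isomorphism:
  the field operations and the valuation of \<open>L\<close> are continuous and extend those of \<open>K\<close>.\<close>

definition val_completion ::
  "('k::field \<Rightarrow> real) \<Rightarrow> ('l::field \<Rightarrow> real) \<Rightarrow> ('k \<Rightarrow> 'l) \<Rightarrow> bool" where
  "val_completion \<nu> \<mu> \<iota> \<longleftrightarrow>
     valuation \<mu> \<and>
     \<iota> 1 = 1 \<and> (\<forall>a b. \<iota> (a + b) = \<iota> a + \<iota> b) \<and> (\<forall>a b. \<iota> (a * b) = \<iota> a * \<iota> b) \<and>
     (\<forall>a. \<mu> (\<iota> a) = \<nu> a) \<and>
     val_topology \<mu> closure_of range \<iota> = UNIV \<and>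
     Metric_space.mcomplete UNIV (val_dist \<mu>)"


section \<open>Compatible topologies\<close>

definition compatible_topologies ::
  "'k topology \<Rightarrow> ('k \<Rightarrow> 'z \<Rightarrow> 'z) \<Rightarrow> 'z::ab_group_add topology set" where
  "compatible_topologies Tk s =
     {T. topspace T = UNIV \<and>
         continuous_map (prod_topology T T) T (\<lambda>(x, y). x + y) \<and>
         continuous_map (prod_topology Tk T) T (\<lambda>(a, x). s a x)}"

definition topology_subset :: "'z topology \<Rightarrow> 'z topology \<Rightarrow> bool" where
  "topology_subset T T' \<longleftrightarrow> {U. openin T U} \<subseteq> {U. openin T' U}"

definition max_compatible_topology ::
  "'k topology \<Rightarrow> ('k \<Rightarrow> 'z \<Rightarrow> 'z) \<Rightarrow> 'z::ab_group_add topology" where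
  "max_compatible_topology Tk s =
     (THE T. T \<in> compatible_topologies Tk s \<and>
             (\<forall>T' \<in> compatible_topologies Tk s. topology_subset T' T))"


section \<open>Extension of scalars\<close>

text \<open>The subgroup of the free abelian group on \<open>L \<times> X\<close> that defines the tensor product
  of \<open>L\<close> and \<open>X\<close> over \<open>K\<close>, where \<open>K\<close> acts on \<open>L\<close> through \<open>\<iota>\<close>.\<close>

definition tensor_relations ::
  "('k \<Rightarrow> 'l::field) \<Rightarrow> ('k \<Rightarrow> 'x \<Rightarrow> 'x) \<Rightarrow> (('l \<times> 'x::ab_group_add) \<Rightarrow>\<^sub>0 int) set" where
  "tensor_relations \<iota> s = group_closure
     ({Poly_Mapping.single (a + b, x) 1 - Poly_Mapping.single (a, x) 1
         - Poly_Mapping.single (b, x) 1 | a b x. True} \<union>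
      {Poly_Mapping.single (a, x + y) 1 - Poly_Mapping.single (a, x) 1
         - Poly_Mapping.single (a, y) 1 | a x y. True} \<union>
      {Poly_Mapping.single (a * \<iota> c, x) 1 - Poly_Mapping.single (a, s c x) 1 | a c x. True})"

text \<open>The \<open>L\<close>-vector space \<open>Y\<close> with the map \<open>(a, x) \<mapsto> tensor a x\<close> is the tensor product of
  \<open>L\<close> and \<open>X\<close> over \<open>K\<close>: the canonical homomorphism from the free abelian group on \<open>L \<times> X\<close>
  to \<open>Y\<close> identifies \<open>Y\<close> with the quotient by the tensor relations, and \<open>L\<close> acts on the
  left factor.\<close>

definition scalar_extension ::
  "('k::field \<Rightarrow> 'l::field) \<Rightarrow> ('k \<Rightarrow> 'x \<Rightarrow> 'x::ab_group_add) \<Rightarrow>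
   ('l \<Rightarrow> 'y \<Rightarrow> 'y::ab_group_add) \<Rightarrow> ('l \<Rightarrow> 'x \<Rightarrow> 'y) \<Rightarrow> bool" where
  "scalar_extension \<iota> sX sY tensor \<longleftrightarrow>
     vector_space sY \<and>
     (\<forall>a b x. sY a (tensor b x) = tensor (a * b) x) \<and>
     (\<exists>\<phi>. Modules.additive \<phi> \<and>
          (\<forall>a x. \<phi> (Poly_Mapping.single (a, x) 1) = tensor a x) \<and>
          surj \<phi> \<and> {z. \<phi> z = 0} = tensor_relations \<iota> sX)"


section \<open>The correspondence between topologies and subspaces\<close>

definition quotient_proj :: "'y set \<Rightarrow> 'y \<Rightarrow> 'y::ab_group_add set" where
  "quotient_proj S x = (\<lambda>y. x + y) ` S"

text \<open>\<open>range (quotient_proj S)\<close> is the quotient space modulo \<open>S\<close>.\<close>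

definition saturated_topology :: "'y topology \<Rightarrow> 'y set \<Rightarrow> 'y::ab_group_add topology" where
  "saturated_topology T S =
     topology (\<lambda>W. \<exists>V \<subseteq> range (quotient_proj S). W = quotient_proj S -` V \<and> openin T W)"

lemma openin_saturated_topology:
  "openin (saturated_topology T S) W \<longleftrightarrow>
     (\<exists>V \<subseteq> range (quotient_proj S). W = quotient_proj S -` V \<and> openin T W)"
proof -
  let ?p = "quotient_proj S"
  let ?P = "\<lambda>W. \<exists>V \<subseteq> range ?p. W = ?p -` V \<and> openin T W"
  have "istopology ?P"
    unfolding istopology_def
  proof (rule conjI; intro allI impI)
    fix A B assume A: "?P A" and B: "?P B"
    from A obtain V where V: "V \<subseteq> range ?p" "A = ?p -` V" "openin T A" by (elim exE conjE)
    from B obtain W where W: "B = ?p -` W" "openin T B" by (elim exE conjE)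
    have "V \<inter> W \<subseteq> range ?p" using V(1) by (rule le_infI1)
    moreover have "A \<inter> B = ?p -` (V \<inter> W)" by (simp only: V(2) W(1) vimage_Int)
    moreover have "openin T (A \<inter> B)" using V(3) W(2) by (rule openin_Int)
    ultimately show "?P (A \<inter> B)" by (intro exI conjI)
  next
    fix \<K> assume *: "\<forall>A\<in>\<K>. ?P A"
    have vimage_image: "f -` f ` f -` V = f -` V" for f :: "'a \<Rightarrow> 'b" and V by auto
    have sat: "?p -` ?p ` A = A" if "A \<in> \<K>" for A
    proof -
      from bspec[OF * that] obtain V where "A = ?p -` V" by (elim exE conjE)
      then show ?thesis by (simp only: vimage_image)
    qed
    have "\<Union>\<K> = ?p -` (\<Union>A\<in>\<K>. ?p ` A)"
      using sat by (simp add: vimage_UN)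
    moreover have "openin T (\<Union>\<K>)"
    proof (rule openin_Union)
      fix A assume "A \<in> \<K>"
      from bspec[OF * this] show "openin T A" by (elim exE conjE)
    qed
    moreover have "(\<Union>A\<in>\<K>. ?p ` A) \<subseteq> range ?p" by (intro UN_least image_mono subset_UNIV)
    ultimately show "?P (\<Union>\<K>)" by (intro exI conjI)
  qed
  then show ?thesis by (simp add: saturated_topology_def topology_inverse')
qed

definition F_hat ::
  "('l::field \<Rightarrow> real) \<Rightarrow> ('l \<Rightarrow> 'y \<Rightarrow> 'y::ab_group_add) \<Rightarrow> ('l \<Rightarrow> 'x \<Rightarrow> 'y) \<Rightarrow>
   'x::ab_group_add topology \<Rightarrow> 'y set" where
  "F_hat \<mu> sY tensor T =
     (\<Inter>U \<in> {U. openin T U \<and> 0 \<in> U}.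
        max_compatible_topology (val_topology \<mu>) sY closure_of (tensor 1 ` U))"

definition G_hat ::
  "('l::field \<Rightarrow> real) \<Rightarrow> ('l \<Rightarrow> 'y \<Rightarrow> 'y::ab_group_add) \<Rightarrow> ('l \<Rightarrow> 'x \<Rightarrow> 'y) \<Rightarrow>
   'y set \<Rightarrow> 'x::ab_group_add topology" where
  "G_hat \<mu> sY tensor S =
     pullback_topology UNIV (tensor 1)
       (saturated_topology (max_compatible_topology (val_topology \<mu>) sY) S)"

end

theory Submission
  imports Defs
begin

text \<open>
  In finite dimension the maximal compatible topology is given by the norm \<open>N\<close> that sums the
  valuations of the coordinates. If \<open>P\<close> is a linear projection of \<open>L \<otimes> X\<close> with kernel \<open>S\<close>, then
  \<open>G S\<close> is the topology of the seminorm \<open>x \<mapsto> N (P (I x))\<close>, and \<open>F (G S) = S\<close> because \<open>I\<close> has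
  dense range and \<open>P\<close> is bounded. For \<open>G (F T) = T\<close> with \<open>S = F T\<close>, a \<open>T\<close>-neighbourhood of \<open>0\<close>
  contains a seminorm ball since \<open>S\<close> lies in the closure of every \<open>I ` V\<close> and \<open>T\<close> is coarser than
  the norm topology. Conversely, if no balanced \<open>T\<close>-neighbourhood of \<open>0\<close> were contained in a given
  seminorm ball, then scaling into a shell and local compactness of \<open>L\<close> would produce a
  point outside \<open>S\<close> that lies in the closure of every \<open>I ` V\<close>.
\<close>

section \<open>Topologies defined by seminorms\<close>

text \<open>Defined by balls rather than as a metric space, because \<open>q\<close> may vanish at
  nonzero vectors and the topology need not be Hausdorff. The family is a topology for any function
  \<open>q\<close>; openness of the balls themselves takes the triangle inequality.\<close>

definition seminorm_topology :: "('v::ab_group_add \<Rightarrow> real) \<Rightarrow> 'v topology" where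
  "seminorm_topology q = topology (\<lambda>U. \<forall>x\<in>U. \<exists>r>0. \<forall>y. q (y - x) < r \<longrightarrow> y \<in> U)"

lemma openin_seminorm_topology:
  "openin (seminorm_topology q) U \<longleftrightarrow> (\<forall>x\<in>U. \<exists>r>0. \<forall>y. q (y - x) < r \<longrightarrow> y \<in> U)"
proof -
  let ?P = "\<lambda>U. \<forall>x\<in>U. \<exists>r>0. \<forall>y. q (y - x) < r \<longrightarrow> y \<in> U"
  have "istopology ?P"
    unfolding istopology_def
  proof (intro conjI allI impI ballI)
    fix A B x assume "?P A" "?P B" "x \<in> A \<inter> B"
    then obtain r s where "r > 0" "\<forall>y. q (y - x) < r \<longrightarrow> y \<in> A" "s > 0" "\<forall>y. q (y - x) < s \<longrightarrow> y \<in> B"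
      by blast
    then show "\<exists>r>0. \<forall>y. q (y - x) < r \<longrightarrow> y \<in> A \<inter> B"
      by (intro exI[of _ "min r s"]) auto
  next
    fix \<K> x assume "\<forall>A\<in>\<K>. ?P A" "x \<in> \<Union>\<K>"
    then show "\<exists>r>0. \<forall>y. q (y - x) < r \<longrightarrow> y \<in> \<Union>\<K>"
      by (meson UnionE UnionI)
  qed
  then show ?thesis
    by (simp add: seminorm_topology_def topology_inverse')
qed

lemma topspace_seminorm_topology [simp]: "topspace (seminorm_topology q) = UNIV"
proof -
  have "openin (seminorm_topology q) UNIV"
    unfolding openin_seminorm_topology using zero_less_one by blast
  then show ?thesis
    using openin_subset by blast
qed

lemma seminorm_topology_eqI:
  assumes "\<And>U. openin T U \<longleftrightarrow> (\<forall>x\<in>U. \<exists>r>0. \<forall>y. q (y - x) < r \<longrightarrow> y \<in> U)"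
  shows "T = seminorm_topology q"
  by (simp add: topology_eq assms openin_seminorm_topology)

lemma continuous_map_prodI:
  assumes "topspace X = UNIV" "topspace Y = UNIV" "topspace Z = UNIV"
    and "\<And>U x y. openin Z U \<Longrightarrow> f x y \<in> U \<Longrightarrow>
      \<exists>V W. openin X V \<and> openin Y W \<and> x \<in> V \<and> y \<in> W \<and> (\<forall>x'\<in>V. \<forall>y'\<in>W. f x' y' \<in> U)"
  shows "continuous_map (prod_topology X Y) Z (\<lambda>(x, y). f x y)"
  unfolding continuous_map_def
proof (intro conjI allI impI)
  fix U assume "openin Z U"
  then have "openin (prod_topology X Y) {(x, y). f x y \<in> U}"
    unfolding openin_prod_topology_alt
    using assms(4) by (fastforce simp: subset_iff)
  then show "openin (prod_topology X Y) {z \<in> topspace (prod_topology X Y). (case z of (x, y) \<Rightarrow> f x y) \<in> U}"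
    using assms by (simp add: case_prod_unfold)
qed (use assms in auto)

lemma continuous_map_prodE:
  assumes "continuous_map (prod_topology X Y) Z (\<lambda>(x, y). f x y)"
    and "topspace X = UNIV" "topspace Y = UNIV" "openin Z U" "f x y \<in> U"
  obtains V W where "openin X V" "openin Y W" "x \<in> V" "y \<in> W"
    "\<And>x' y'. x' \<in> V \<Longrightarrow> y' \<in> W \<Longrightarrow> f x' y' \<in> U"
proof -
  have "openin (prod_topology X Y) {z. (case z of (x, y) \<Rightarrow> f x y) \<in> U}"
    using openin_continuous_map_preimage[OF assms(1,4)] assms(2,3) by simp
  then have "\<exists>V W. openin X V \<and> openin Y W \<and> x \<in> V \<and> y \<in> W \<and>
      V \<times> W \<subseteq> {z. (case z of (x, y) \<Rightarrow> f x y) \<in> U}"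
    unfolding openin_prod_topology_alt using assms(5) by simp
  then show ?thesis
    using that by (auto simp: subset_iff)
qed

section \<open>Valuations and the topology of their metric\<close>

locale valuation_field =
  fixes \<nu> :: "'k::field \<Rightarrow> real"
  assumes valuation: "valuation \<nu>"
begin

lemma val_nonneg [simp]: "0 \<le> \<nu> a"
  and val_eq_0 [simp]: "\<nu> a = 0 \<longleftrightarrow> a = 0"
  and val_mult: "\<nu> (a * b) = \<nu> a * \<nu> b"
  and val_add: "\<nu> (a + b) \<le> \<nu> a + \<nu> b"
  using valuation unfolding valuation_def by auto

lemma val_zero [simp]: "\<nu> 0 = 0"
  by simp

lemma val_one [simp]: "\<nu> 1 = 1"
  using val_mult[of 1 1] by simp

lemma val_pos [simp]: "0 < \<nu> a \<longleftrightarrow> a \<noteq> 0"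
  using val_nonneg[of a] val_eq_0[of a] by linarith

lemma val_power: "\<nu> (a ^ n) = \<nu> a ^ n"
  by (induction n) (auto simp: val_mult)

lemma val_minus [simp]: "\<nu> (- a) = \<nu> a"
proof -
  have "(\<nu> (- 1))\<^sup>2 = 1"
    using val_mult[of "-1" "-1"] by (simp add: power2_eq_square)
  then have "\<nu> (- 1) = 1"
    using val_nonneg[of "-1"] by (auto simp: power2_eq_1_iff)
  then show ?thesis
    using val_mult[of "-1" a] by simp
qed

lemma val_topology_eq: "val_topology \<nu> = seminorm_topology \<nu>"
proof (rule seminorm_topology_eqI)
  interpret Metric_space UNIV "val_dist \<nu>"
    by (rule valuation_Metric_space[OF valuation])
  have "val_dist \<nu> x y = \<nu> (y - x)" for x y
    using commute[of x y] by (simp add: val_dist_def)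
  then show "openin (val_topology \<nu>) U \<longleftrightarrow> (\<forall>x\<in>U. \<exists>r>0. \<forall>y. \<nu> (y - x) < r \<longrightarrow> y \<in> U)" for U
    unfolding val_topology_def openin_mtopology by (auto simp: subset_iff)
qed

text \<open>Without such a \<open>p\<close> the open unit ball would be {0}, so every set would be
  open. The powers of \<open>p\<close> later serve as arbitrarily small nonzero scalars.\<close>

lemma nontrivial_obtains:
  assumes "nontrivial_valuation \<nu>"
  obtains p where "0 < \<nu> p" "\<nu> p < 1"
proof (rule ccontr)
  assume "\<not> thesis"
  with that have "p = 0" if "\<nu> p < 1" for p
    using that val_pos by blast
  then have "openin (val_topology \<nu>) U" for U
    unfolding val_topology_eq openin_seminorm_topology
    by (intro ballI exI[of _ "1::real"]) force
  then have "val_topology \<nu> = discrete_topology UNIV"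
    by (simp add: topology_eq)
  with assms show False
    by (simp add: nontrivial_valuation_def)
qed

end

section \<open>Seminorms over a valuation field\<close>

locale valuation_seminorm = vector_space s + valuation_field \<nu>
  for s :: "'k::field \<Rightarrow> 'v::ab_group_add \<Rightarrow> 'v" and \<nu> +
  fixes q :: "'v \<Rightarrow> real"
  assumes seminorm_add: "q (x + y) \<le> q x + q y"
    and seminorm_scale: "q (s a x) = \<nu> a * q x"

text \<open>Regarding the field as a vector space over itself makes the facts on seminorm balls,
  closures and compatibility available for the field topology.\<close>

lemma (in valuation_field) valuation_seminorm_field: "valuation_seminorm (*) \<nu> \<nu>"
  by unfold_locales (auto simp: algebra_simps val_add val_mult)

context valuation_seminorm
begin

lemma seminorm_zero [simp]: "q 0 = 0"
  using seminorm_scale[of 0 0] by simp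

lemma seminorm_minus [simp]: "q (- x) = q x"
  using seminorm_scale[of "- 1" x] by simp

lemma seminorm_diff: "q (x - y) \<le> q x + q y"
  using seminorm_add[of x "- y"] by simp

lemma seminorm_nonneg [simp]: "0 \<le> q x"
  using seminorm_add[of x "- x"] by simp

lemma seminorm_triangle: "q (x - z) \<le> q (x - y) + q (y - z)"
  using seminorm_add[of "x - y" "y - z"] by simp

lemma openin_seminorm_ball: "openin (seminorm_topology q) {y. q (y - x) < r}"
  unfolding openin_seminorm_topology
proof safe
  fix y assume y: "q (y - x) < r"
  then show "\<exists>\<epsilon>>0. \<forall>z. q (z - y) < \<epsilon> \<longrightarrow> z \<in> {y. q (y - x) < r}"
    using seminorm_triangle[of _ x y] by (intro exI[of _ "r - q (y - x)"]) (smt (verit) mem_Collect_eq)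
qed

lemma seminorm_closure_of:
  "y \<in> seminorm_topology q closure_of A \<longleftrightarrow> (\<forall>r>0. \<exists>a\<in>A. q (a - y) < r)"
proof
  assume y: "y \<in> seminorm_topology q closure_of A"
  show "\<forall>r>0. \<exists>a\<in>A. q (a - y) < r"
  proof safe
    fix r :: real assume "r > 0"
    with openin_seminorm_ball[of y r] have "\<exists>a. a \<in> A \<and> a \<in> {z. q (z - y) < r}"
      using y[unfolded in_closure_of, THEN conjunct2, rule_format, of "{z. q (z - y) < r}"] by simp
    then show "\<exists>a\<in>A. q (a - y) < r"
      by blast
  qed
next
  assume A: "\<forall>r>0. \<exists>a\<in>A. q (a - y) < r"
  show "y \<in> seminorm_topology q closure_of A"
    unfolding in_closure_of
  proof (intro conjI allI impI; (elim conjE)?)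
    fix U assume "y \<in> U" "openin (seminorm_topology q) U"
    then obtain r where "r > 0" "\<forall>z. q (z - y) < r \<longrightarrow> z \<in> U"
      unfolding openin_seminorm_topology by blast
    with A show "\<exists>a. a \<in> A \<and> a \<in> U"
      by blast
  qed simp
qed

lemma seminorm_topology_compatible:
  "seminorm_topology q \<in> compatible_topologies (val_topology \<nu>) s"
proof -
  have val_ball: "openin (val_topology \<nu>) {b. \<nu> (b - a) < r}" for a r
  proof -
    interpret K: valuation_seminorm "(*)" \<nu> \<nu>
      by (rule valuation_seminorm_field)
    show ?thesis
      unfolding val_topology_eq by (rule K.openin_seminorm_ball)
  qed
  have "continuous_map (prod_topology (seminorm_topology q) (seminorm_topology q))
      (seminorm_topology q) (\<lambda>(x, y). x + y)"
  proof (rule continuous_map_prodI)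
    fix U and x y :: 'v
    assume "openin (seminorm_topology q) U" "x + y \<in> U"
    then obtain r where r: "r > 0" "\<And>z. q (z - (x + y)) < r \<Longrightarrow> z \<in> U"
      unfolding openin_seminorm_topology by blast
    have "x' + y' \<in> U" if "q (x' - x) < r/2" "q (y' - y) < r/2" for x' y'
      using r(2)[of "x' + y'"] seminorm_add[of "x' - x" "y' - y"] that
      by (simp add: algebra_simps)
    then show "\<exists>V W. openin (seminorm_topology q) V \<and> openin (seminorm_topology q) W \<and>
        x \<in> V \<and> y \<in> W \<and> (\<forall>x'\<in>V. \<forall>y'\<in>W. x' + y' \<in> U)"
      using r(1)
      by (intro exI[of _ "{z. q (z - x) < r/2}"] exI[of _ "{z. q (z - y) < r/2}"] conjI openin_seminorm_ball)
        auto
  qed auto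
  moreover have "continuous_map (prod_topology (val_topology \<nu>) (seminorm_topology q))
      (seminorm_topology q) (\<lambda>(a, x). s a x)"
  proof (rule continuous_map_prodI)
    fix U a x
    assume "openin (seminorm_topology q) U" "s a x \<in> U"
    then obtain r where r: "r > 0" "\<And>z. q (z - s a x) < r \<Longrightarrow> z \<in> U"
      unfolding openin_seminorm_topology by blast
    \<comment> \<open>The radii match the splitting s a' x' - s a x = s a' (x' - x) + s (a' - a) x.
      The bound 1 on \<alpha> gives \<nu> a' \<le> \<nu> a + 1, so each term contributes at most
      r/2, the first strictly less. Adding 1 in the denominators avoids division by zero.\<close>
    define \<alpha> where "\<alpha> = min 1 (r / (2 * (q x + 1)))"
    define \<beta> where "\<beta> = r / (2 * (\<nu> a + 1))"
    have pos: "q x + 1 > 0" "\<nu> a + 1 > 0"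
      using seminorm_nonneg[of x] val_nonneg[of a] by linarith+
    have half: "r / (2 * D) * D = r/2" if "D > 0" for D
      using that by simp
    have \<alpha>: "\<alpha> > 0" "\<alpha> \<le> 1" "\<alpha> * q x \<le> r/2"
    proof -
      show "\<alpha> > 0" "\<alpha> \<le> 1"
        using r(1) pos by (auto simp: \<alpha>_def)
      have "\<alpha> * q x \<le> r / (2 * (q x + 1)) * (q x + 1)"
        using r(1) pos by (intro mult_mono) (auto simp: \<alpha>_def)
      then show "\<alpha> * q x \<le> r/2"
        unfolding half[OF pos(1)] .
    qed
    have \<beta>: "\<beta> > 0" "(\<nu> a + 1) * \<beta> = r/2"
      using r(1) pos half[OF pos(2)] by (auto simp: \<beta>_def mult.commute)
    have "s a' x' \<in> U" if "\<nu> (a' - a) < \<alpha>" "q (x' - x) < \<beta>" for a' x'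
    proof (rule r(2))
      have "\<nu> a' \<le> \<nu> a + 1"
        using val_add[of "a' - a" a] that \<alpha>(2) by simp
      have "s a' x' - s a x = s a' (x' - x) + s (a' - a) x"
        by (simp add: algebra_simps scale_left_diff_distrib scale_right_diff_distrib)
      then have "q (s a' x' - s a x) \<le> \<nu> a' * q (x' - x) + \<nu> (a' - a) * q x"
        by (metis seminorm_add seminorm_scale)
      also have "\<nu> (a' - a) * q x \<le> \<alpha> * q x"
        using that by (intro mult_right_mono) auto
      also have "\<nu> a' * q (x' - x) \<le> (\<nu> a + 1) * q (x' - x)"
        using \<open>\<nu> a' \<le> \<nu> a + 1\<close> by (intro mult_right_mono) auto
      also have "(\<nu> a + 1) * q (x' - x) < (\<nu> a + 1) * \<beta>"
        using that pos by (intro mult_strict_left_mono) auto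
      finally show "q (s a' x' - s a x) < r"
        using \<alpha> \<beta> by simp
    qed
    then show "\<exists>V W. openin (val_topology \<nu>) V \<and> openin (seminorm_topology q) W \<and>
        a \<in> V \<and> x \<in> W \<and> (\<forall>a'\<in>V. \<forall>x'\<in>W. s a' x' \<in> U)"
      using \<alpha>(1) \<beta>(1)
      by (intro exI[of _ "{b. \<nu> (b - a) < \<alpha>}"] exI[of _ "{z. q (z - x) < \<beta>}"] conjI
          val_ball openin_seminorm_ball) auto
  qed (auto simp: val_topology_eq)
  ultimately show ?thesis
    by (simp add: compatible_topologies_def)
qed

end

section \<open>Compatible topologies\<close>

locale compatible_topology = vector_space s + valuation_field \<nu>
  for s :: "'k::field \<Rightarrow> 'v::ab_group_add \<Rightarrow> 'v" and \<nu> +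
  fixes T :: "'v topology"
  assumes compatible: "T \<in> compatible_topologies (val_topology \<nu>) s"
begin

lemma topspace_compatible [simp]: "topspace T = UNIV"
  and continuous_map_plus: "continuous_map (prod_topology T T) T (\<lambda>(x, y). x + y)"
  and continuous_map_scale: "continuous_map (prod_topology (val_topology \<nu>) T) T (\<lambda>(a, x). s a x)"
  using compatible by (auto simp: compatible_topologies_def)

lemma continuous_map_translation: "continuous_map T T (\<lambda>y. x + y)"
proof -
  have "continuous_map T (prod_topology T T) (\<lambda>y. (x, y))"
    by (intro continuous_map_pairedI) auto
  from continuous_map_compose[OF this continuous_map_plus] show ?thesis
    by (simp add: o_def)
qed

lemma continuous_map_scale_right: "continuous_map T T (s a)"
proof -
  have "continuous_map T (prod_topology (val_topology \<nu>) T) (\<lambda>y. (a, y))"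
    by (intro continuous_map_pairedI) (auto simp: val_topology_eq)
  from continuous_map_compose[OF this continuous_map_scale] show ?thesis
    by (simp add: o_def)
qed

lemma openin_translation:
  assumes "openin T U" shows "openin T {y. x + y \<in> U}"
  using openin_continuous_map_preimage[OF continuous_map_translation assms, of x] by simp

lemma openin_scale_preimage:
  assumes "openin T U" shows "openin T {y. s a y \<in> U}"
  using openin_continuous_map_preimage[OF continuous_map_scale_right assms, of a] by simp

lemma openin_scale_image:
  assumes "openin T U" "a \<noteq> 0" shows "openin T (s a ` U)"
proof -
  have "s a ` U = {y. s (inverse a) y \<in> U}"
    using assms(2) by (auto simp: image_iff intro!: bexI[of _ "s (inverse a) _"])
  with openin_scale_preimage[OF assms(1)] show ?thesis
    by simp
qed

lemma zero_nbhd_sum: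
  assumes "openin T U" "0 \<in> U"
  obtains V where "openin T V" "0 \<in> V" "\<And>x y. x \<in> V \<Longrightarrow> y \<in> V \<Longrightarrow> x + y \<in> U"
proof -
  obtain V W where V: "openin T V" "openin T W" "0 \<in> V" "0 \<in> W"
    "\<And>x y. x \<in> V \<Longrightarrow> y \<in> W \<Longrightarrow> x + y \<in> U"
    using continuous_map_prodE[OF continuous_map_plus _ _ assms(1), of 0 0] assms(2) by auto
  then show ?thesis
    using that[of "V \<inter> W"] by auto
qed

text \<open>Continuity of scaling at (0, 0) yields \<open>W\<close> and \<open>r\<close> such that
  \<open>W\<close> is mapped into \<open>U\<close> by all scalars of valuation below
  \<open>r\<close>. The union of such multiples of \<open>W\<close> is stable under scalars of
  valuation at most 1.\<close>

lemma zero_nbhd_balanced: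
  assumes "openin T U" "0 \<in> U" "nontrivial_valuation \<nu>"
  obtains V where "openin T V" "0 \<in> V" "V \<subseteq> U" "\<And>a x. x \<in> V \<Longrightarrow> \<nu> a \<le> 1 \<Longrightarrow> s a x \<in> V"
proof -
  obtain A W where W: "openin (val_topology \<nu>) A" "openin T W" "0 \<in> A" "0 \<in> W"
    "\<And>a x. a \<in> A \<Longrightarrow> x \<in> W \<Longrightarrow> s a x \<in> U"
    using continuous_map_prodE[OF continuous_map_scale _ _ assms(1), of 0 0] assms(2)
    by (auto simp: val_topology_eq)
  from W(1,3) obtain r where r: "r > 0" "\<And>a. \<nu> a < r \<Longrightarrow> a \<in> A"
    unfolding val_topology_eq openin_seminorm_topology by force
  obtain p where p: "0 < \<nu> p" "\<nu> p < 1"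
    using nontrivial_obtains[OF assms(3)] .
  from real_arch_pow_inv[OF r(1) p(2)] obtain n where n: "\<nu> p ^ n < r"
    by blast
  \<comment> \<open>The scalar 0 is left out so that every multiple of \<open>W\<close> is open.
    Nontriviality then supplies the nonzero scalar \<open>p ^ n\<close> needed to have 0 in
    \<open>V\<close>.\<close>
  define V where "V = (\<Union>a\<in>{a. a \<noteq> 0 \<and> \<nu> a < r}. s a ` W)"
  have "openin T V"
    unfolding V_def using W(2) by (auto intro: openin_scale_image)
  moreover have pn: "p ^ n \<in> {a. a \<noteq> 0 \<and> \<nu> a < r}"
    using n p by (auto simp: val_power)
  then have "s (p ^ n) 0 \<in> V"
    unfolding V_def using W(4) by blast
  then have "0 \<in> V"
    by simp
  moreover have "V \<subseteq> U"
    using r W(5) by (auto simp: V_def)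
  moreover have "s a x \<in> V" if x: "x \<in> V" and a: "\<nu> a \<le> 1" for a x
  proof (cases "a = 0")
    case False
    from x obtain b w where b: "b \<noteq> 0" "\<nu> b < r" "w \<in> W" "x = s b w"
      by (auto simp: V_def)
    have "\<nu> (a * b) < r"
      using mult_right_mono[OF a, of "\<nu> b"] b(2) by (simp add: val_mult)
    then show ?thesis
      using b False unfolding V_def by (intro UN_I[of "a * b"]) auto
  qed (use \<open>0 \<in> V\<close> in simp)
  ultimately show ?thesis
    using that by blast
qed

text \<open>Translations are continuous with continuous inverses. Hence two compatible topologies
  can be compared by their neighbourhoods of 0 alone.\<close>

lemma openin_iff_zero_nbhd:
  "openin T U \<longleftrightarrow> (\<forall>x\<in>U. \<exists>V. openin T V \<and> 0 \<in> V \<and> (\<forall>y\<in>V. x + y \<in> U))"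
proof
  assume U: "openin T U"
  show "\<forall>x\<in>U. \<exists>V. openin T V \<and> 0 \<in> V \<and> (\<forall>y\<in>V. x + y \<in> U)"
  proof
    fix x assume "x \<in> U"
    then show "\<exists>V. openin T V \<and> 0 \<in> V \<and> (\<forall>y\<in>V. x + y \<in> U)"
      using openin_translation[OF U, of x] by (intro exI[of _ "{y. x + y \<in> U}"]) simp
  qed
next
  assume *: "\<forall>x\<in>U. \<exists>V. openin T V \<and> 0 \<in> V \<and> (\<forall>y\<in>V. x + y \<in> U)"
  show "openin T U"
  proof (subst openin_subopen, safe)
    fix x assume "x \<in> U"
    then obtain V where V: "openin T V" "0 \<in> V" "\<And>y. y \<in> V \<Longrightarrow> x + y \<in> U"
      using bspec[OF *, of x] by blast
    have "openin T {y. - x + y \<in> V}"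
      by (rule openin_translation[OF V(1)])
    moreover have "y \<in> U" if "- x + y \<in> V" for y
      using V(3)[OF that] by simp
    ultimately show "\<exists>W. openin T W \<and> x \<in> W \<and> W \<subseteq> U"
      using V(2) by (intro exI[of _ "{y. - x + y \<in> V}"]) auto
  qed
qed

text \<open>This map from coordinate tuples to vectors is used twice: to compare an arbitrary
  compatible topology with the norm topology, and to carry compact products of scalars to compact
  sets of vectors.\<close>

lemma continuous_map_linear_combination:
  assumes "finite A" "A \<subseteq> B"
  shows "continuous_map (product_topology (\<lambda>_. val_topology \<nu>) B) T (\<lambda>f. \<Sum>b\<in>A. s (f b) (e b))"
  using assms
proof (induction A)
  case (insert b A)
  let ?P = "product_topology (\<lambda>_. val_topology \<nu>) B"
  have "continuous_map ?P (val_topology \<nu>) (\<lambda>f. f b)"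
    using insert.prems continuous_map_product_projection[of b B "\<lambda>_. val_topology \<nu>"] by simp
  then have "continuous_map ?P (prod_topology (val_topology \<nu>) T) (\<lambda>f. (f b, e b))"
    by (intro continuous_map_pairedI) auto
  from continuous_map_compose[OF this continuous_map_scale]
  have "continuous_map ?P T (\<lambda>f. s (f b) (e b))"
    by (simp add: o_def)
  moreover have "continuous_map ?P T (\<lambda>f. \<Sum>b\<in>A. s (f b) (e b))"
    using insert by simp
  ultimately have "continuous_map ?P (prod_topology T T) (\<lambda>f. (s (f b) (e b), \<Sum>b\<in>A. s (f b) (e b)))"
    by (intro continuous_map_pairedI) auto
  from continuous_map_compose[OF this continuous_map_plus] show ?case
    using insert by (simp add: o_def)
qed simp

end

text \<open>Local compactness gives a compact set that contains some small ball around 0;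
  multiplication by a high power of the inverse of \<open>p\<close> is continuous and enlarges that
  ball as far as desired.\<close>

lemma (in valuation_field) compact_val_ball:
  assumes "locally_compact_space (val_topology \<nu>)" "0 < \<nu> p" "\<nu> p < 1"
  obtains C where "compactin (val_topology \<nu>) C" "{a. \<nu> a \<le> r} \<subseteq> C"
proof -
  interpret K: valuation_seminorm "(*)" \<nu> \<nu>
    by (rule valuation_seminorm_field)
  interpret K: compatible_topology "(*)" \<nu> "val_topology \<nu>"
    using K.seminorm_topology_compatible by unfold_locales (simp add: val_topology_eq)
  have "\<exists>U C. openin (val_topology \<nu>) U \<and> compactin (val_topology \<nu>) C \<and> 0 \<in> U \<and> U \<subseteq> C"
    using assms(1) unfolding locally_compact_space_def by (simp add: val_topology_eq)
  then obtain U C where C: "openin (val_topology \<nu>) U" "compactin (val_topology \<nu>) C" "0 \<in> U" "U \<subseteq> C"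
    by blast
  then obtain d where d: "d > 0" "\<And>a. \<nu> a < d \<Longrightarrow> a \<in> U"
    unfolding val_topology_eq openin_seminorm_topology by fastforce
  \<comment> \<open>The denominator is positive and exceeds \<open>r\<close> whatever the sign of
    \<open>r\<close>.\<close>
  have pos: "0 < d / (\<bar>r\<bar> + 1)"
    using d(1) by simp
  obtain n where n: "\<nu> p ^ n < d / (\<bar>r\<bar> + 1)"
    using real_arch_pow_inv[OF pos assms(3)] by blast
  have "p \<noteq> 0"
    using assms(2) by auto
  let ?C = "(*) (inverse (p ^ n)) ` C"
  have "compactin (val_topology \<nu>) ?C"
    by (rule image_compactin[OF C(2) K.continuous_map_scale_right])
  moreover have "{a. \<nu> a \<le> r} \<subseteq> ?C"
  proof safe
    fix a assume "\<nu> a \<le> r"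
    then have "\<nu> p ^ n * \<nu> a \<le> \<nu> p ^ n * (\<bar>r\<bar> + 1)"
      by (intro mult_left_mono) auto
    also have "\<dots> < d"
      using n by (simp add: pos_less_divide_eq)
    finally have "p ^ n * a \<in> C"
      using d(2)[of "p ^ n * a"] C(4) by (auto simp: val_mult val_power)
    then show "a \<in> ?C"
      using \<open>p \<noteq> 0\<close> by (intro image_eqI[of _ _ "p ^ n * a"]) auto
  qed
  ultimately show ?thesis
    using that by blast
qed

text \<open>A basis \<open>A\<close> of \<open>S\<close> is extended to a basis \<open>E\<close> of
  the whole space; \<open>P\<close> kills \<open>A\<close> and fixes the rest of \<open>E\<close>.
  The range of \<open>P\<close> will serve as a model of the quotient by \<open>S\<close>.\<close>

lemma (in vector_space) linear_projection_along_subspace: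
  assumes "subspace S"
  obtains P where "Vector_Spaces.linear scale scale P" "\<And>x. P x = 0 \<longleftrightarrow> x \<in> S" "\<And>x. P (P x) = P x"
proof -
  interpret vector_space_pair scale scale ..
  obtain A where A: "A \<subseteq> S" "independent A" "S \<subseteq> span A"
    by (rule maximal_independent_subset)
  define E where "E = extend_basis A"
  have E: "A \<subseteq> E" "independent E" "span E = UNIV"
    using extend_basis_superset[OF A(2)] independent_extend_basis[OF A(2)] span_extend_basis[OF A(2)]
    by (auto simp: E_def)
  obtain P where P: "Vector_Spaces.linear scale scale P" "\<And>x. x \<in> E \<Longrightarrow> P x = (if x \<in> A then 0 else x)"
    using linear_independent_extend[OF E(2), of "\<lambda>x. if x \<in> A then 0 else x"] by blast
  interpret P: Vector_Spaces.linear scale scale P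
    by (rule P(1))
  \<comment> \<open>Together with the vanishing of \<open>P\<close> on \<open>S\<close> this gives
    both remaining claims: a vector killed by \<open>P\<close> equals x - P x, and P (x - P x) = 0
    is idempotence.\<close>
  have diff: "x - P x \<in> S" for x
  proof -
    have "x \<in> span E"
      by (simp add: E(3))
    then show ?thesis
    proof (induction rule: span_induct_alt)
      case base
      then show ?case
        using subspace_0[OF assms] by (simp add: P.zero)
    next
      case (step a x y)
      have "x - P x \<in> S"
        using P(2)[OF step(1)] A(1) subspace_0[OF assms] by auto
      moreover have "scale a x + y - P (scale a x + y) = scale a (x - P x) + (y - P y)"
        by (simp add: P.add P.scale scale_right_diff_distrib)
      ultimately show ?case
        using step(2) by (simp only: subspace_add[OF assms] subspace_scale[OF assms])
    qed
  qed
  have S: "P x = 0" if "x \<in> S" for x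
  proof -
    have "x \<in> span A"
      using that A(3) by blast
    then show ?thesis
    proof (induction rule: span_induct_alt)
      case (step a x y)
      then have "P x = 0"
        using P(2)[of x] E(1) by auto
      with step show ?case
        by (simp add: P.add P.scale)
    qed (simp add: P.zero)
  qed
  show ?thesis
  proof (rule that[OF P(1)])
    show "P x = 0 \<longleftrightarrow> x \<in> S" for x
      using diff[of x] S[of x] by auto
    show "P (P x) = P x" for x
      using S[OF diff[of x]] by (simp add: P.diff)
  qed
qed

section \<open>The maximal compatible topology in finite dimension\<close>

text \<open>A basis is represented by linear functionals that reconstruct every vector. This form
  passes to the scalar extension by extending each functional separately.\<close>

locale valued_coordinates = vector_space s + valuation_field \<nu>
  for s :: "'k::field \<Rightarrow> 'v::ab_group_add \<Rightarrow> 'v" and \<nu> :: "'k \<Rightarrow> real" +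
  fixes B :: "'b set" and e :: "'b \<Rightarrow> 'v" and c :: "'b \<Rightarrow> 'v \<Rightarrow> 'k"
  assumes finite_B: "finite B"
    and coord_add: "c b (x + y) = c b x + c b y"
    and coord_scale: "c b (s a x) = a * c b x"
    and expansion: "(\<Sum>b\<in>B. s (c b x) (e b)) = x"
begin

definition N :: "'v \<Rightarrow> real" where
  "N x = (\<Sum>b\<in>B. \<nu> (c b x))"

sublocale N: valuation_seminorm s \<nu> N
proof
  show "N (x + y) \<le> N x + N y" for x y
    unfolding N_def coord_add sum.distrib[symmetric] by (intro sum_mono val_add)
  show "N (s a x) = \<nu> a * N x" for a x
    by (simp add: N_def coord_scale val_mult sum_distrib_left)
qed

lemma coord_le_N: "b \<in> B \<Longrightarrow> \<nu> (c b x) \<le> N x"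
  unfolding N_def by (rule member_le_sum) (auto simp: finite_B)

lemma coord_diff: "c b (x - y) = c b x - c b y"
  using coord_add[of b "x - y" y] by simp

lemma N_eq_0 [simp]: "N x = 0 \<longleftrightarrow> x = 0"
proof
  assume "N x = 0"
  then have "s (c b x) (e b) = 0" if "b \<in> B" for b
    using coord_le_N[OF that, of x] val_nonneg[of "c b x"] by (simp add: order_antisym)
  then show "x = 0"
    using expansion[of x] by (simp only: sum.neutral_const cong: sum.cong)
qed simp

lemma N_pos [simp]: "0 < N x \<longleftrightarrow> x \<noteq> 0"
  using N.seminorm_nonneg[of x] N_eq_0[of x] by linarith

text \<open>The identity factors through tuples of scalars: taking coordinates is continuous for
  \<open>N\<close>, and forming the linear combination is continuous into \<open>T\<close>.\<close>

lemma openin_compatible_imp_openin_N: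
  assumes "T \<in> compatible_topologies (val_topology \<nu>) s" "openin T U"
  shows "openin (seminorm_topology N) U"
proof -
  interpret T: compatible_topology s \<nu> T
    using assms(1) by unfold_locales
  have "continuous_map (seminorm_topology N) (val_topology \<nu>) (c b)" if b: "b \<in> B" for b
    unfolding continuous_map_def
  proof (intro conjI allI impI)
    fix V assume V: "openin (val_topology \<nu>) V"
    show "openin (seminorm_topology N) {x \<in> topspace (seminorm_topology N). c b x \<in> V}"
      unfolding openin_seminorm_topology
    proof safe
      fix x assume "c b x \<in> V"
      then obtain r where r: "r > 0" "\<And>a. \<nu> (a - c b x) < r \<Longrightarrow> a \<in> V"
        using V unfolding val_topology_eq openin_seminorm_topology by blast
      have "c b y \<in> V" if "N (y - x) < r" for y
        using r(2)[of "c b y"] coord_le_N[OF b, of "y - x"] that by (simp add: coord_diff)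
      then show "\<exists>r>0. \<forall>y. N (y - x) < r \<longrightarrow> y \<in> {x \<in> topspace (seminorm_topology N). c b x \<in> V}"
        using r(1) by auto
    qed
  qed (simp add: val_topology_eq)
  then have "continuous_map (seminorm_topology N) (product_topology (\<lambda>_. val_topology \<nu>) B)
      (\<lambda>x. \<lambda>b\<in>B. c b x)"
    by (auto simp: continuous_map_componentwise)
  from continuous_map_compose[OF this T.continuous_map_linear_combination[OF finite_B order_refl, of e]]
  have "continuous_map (seminorm_topology N) T (\<lambda>x. x)"
    by (simp add: o_def expansion)
  then show ?thesis
    using openin_continuous_map_preimage[OF _ assms(2)] by fastforce
qed

lemma max_compatible_topology_eq:
  "max_compatible_topology (val_topology \<nu>) s = seminorm_topology N"
  unfolding max_compatible_topology_def
proof (rule the_equality)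
  show *: "seminorm_topology N \<in> compatible_topologies (val_topology \<nu>) s \<and>
    (\<forall>T\<in>compatible_topologies (val_topology \<nu>) s. topology_subset T (seminorm_topology N))"
    using N.seminorm_topology_compatible openin_compatible_imp_openin_N
    by (auto simp: topology_subset_def)
  show "T = seminorm_topology N"
    if "T \<in> compatible_topologies (val_topology \<nu>) s \<and>
      (\<forall>T'\<in>compatible_topologies (val_topology \<nu>) s. topology_subset T' T)" for T
    using that * unfolding topology_subset_def topology_eq by blast
qed

text \<open>All coordinates of a vector in the ball are bounded by \<open>r\<close>, so the ball
  lies in the image of a product of compact sets of scalars, which is compact by Tychonoff.\<close>

lemma compact_N_ball:
  assumes "locally_compact_space (val_topology \<nu>)" "0 < \<nu> p" "\<nu> p < 1"
  obtains C where "compactin (seminorm_topology N) C" "{x. N x \<le> r} \<subseteq> C"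
proof -
  interpret T: compatible_topology s \<nu> "seminorm_topology N"
    using N.seminorm_topology_compatible by unfold_locales
  obtain D where D: "compactin (val_topology \<nu>) D" "{a. \<nu> a \<le> r} \<subseteq> D"
    using compact_val_ball[OF assms] .
  let ?\<phi> = "\<lambda>f. \<Sum>b\<in>B. s (f b) (e b)"
  have "compactin (product_topology (\<lambda>_. val_topology \<nu>) B) (\<Pi>\<^sub>E b\<in>B. D)"
    using D(1) by (simp add: compactin_PiE)
  then have "compactin (seminorm_topology N) (?\<phi> ` (\<Pi>\<^sub>E b\<in>B. D))"
    by (rule image_compactin) (rule T.continuous_map_linear_combination[OF finite_B order_refl])
  moreover have "{x. N x \<le> r} \<subseteq> ?\<phi> ` (\<Pi>\<^sub>E b\<in>B. D)"
  proof safe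
    fix x assume "N x \<le> r"
    then have "c b x \<in> D" if "b \<in> B" for b
      using coord_le_N[OF that, of x] D(2) by fastforce
    then show "x \<in> ?\<phi> ` (\<Pi>\<^sub>E b\<in>B. D)"
      by (intro image_eqI[of _ _ "\<lambda>b\<in>B. c b x"]) (auto simp: expansion)
  qed
  ultimately show ?thesis
    using that by blast
qed

lemma N_sum: "N (\<Sum>b\<in>A. f b) \<le> (\<Sum>b\<in>A. N (f b))"
proof (induction A rule: infinite_finite_induct)
  case (insert b A)
  then show ?case
    using N.seminorm_add[of "f b" "sum f A"] by simp
qed auto

lemma linear_bound:
  assumes "Vector_Spaces.linear s s P"
  obtains C where "C > 0" "\<And>x. N (P x) \<le> C * N x"
proof
  interpret P: Vector_Spaces.linear s s P
    by fact
  \<comment> \<open>The summand 1 keeps the constant positive even if \<open>P\<close> kills every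
    \<open>e b\<close>; later proofs divide by it.\<close>
  let ?C = "1 + (\<Sum>b\<in>B. N (P (e b)))"
  show "?C > 0"
    using sum_nonneg[of B "\<lambda>b. N (P (e b))"] by (simp add: add_pos_nonneg)
  fix x
  have "P x = (\<Sum>b\<in>B. s (c b x) (P (e b)))"
    by (subst (1) expansion[symmetric]) (simp only: P.sum P.scale)
  then have "N (P x) \<le> (\<Sum>b\<in>B. \<nu> (c b x) * N (P (e b)))"
    using N_sum[of "\<lambda>b. s (c b x) (P (e b))" B] by (simp add: N.seminorm_scale)
  also have "\<dots> \<le> (\<Sum>b\<in>B. N x * N (P (e b)))"
    by (intro sum_mono mult_right_mono) (auto simp: coord_le_N)
  also have "\<dots> \<le> ?C * N x"
    by (simp add: sum_distrib_left[symmetric] algebra_simps)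
  finally show "N (P x) \<le> ?C * N x" .
qed

end

section \<open>The correspondence in coordinates\<close>

lemma quotient_proj_eq_iff:
  assumes "module.subspace s S" "vector_space s"
  shows "quotient_proj S x = quotient_proj S y \<longleftrightarrow> x - y \<in> S"
proof -
  interpret vector_space s by fact
  show ?thesis
  proof
    assume "quotient_proj S x = quotient_proj S y"
    moreover have "x \<in> quotient_proj S x"
      using subspace_0[OF assms(1)] by (force simp: quotient_proj_def)
    ultimately obtain z where "z \<in> S" "x = y + z"
      by (auto simp: quotient_proj_def)
    then show "x - y \<in> S"
      by simp
  next
    have sub: "quotient_proj S x \<subseteq> quotient_proj S y" if xy: "x - y \<in> S" for x y
    proof
      fix w assume "w \<in> quotient_proj S x"
      then obtain z where "z \<in> S" "w = x + z"
        by (auto simp: quotient_proj_def)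
      then show "w \<in> quotient_proj S y"
        using subspace_add[OF assms(1) xy \<open>z \<in> S\<close>]
        by (auto simp: quotient_proj_def image_iff intro!: bexI[of _ "x - y + z"])
    qed
    assume xy: "x - y \<in> S"
    then have "y - x \<in> S"
      using subspace_neg[OF assms(1) xy] by simp
    with xy show "quotient_proj S x = quotient_proj S y"
      using sub by blast
  qed
qed

text \<open>The preimages under the quotient map are exactly the sets stable under translation by
  \<open>S\<close>, so the quotient space can be avoided from here on.\<close>

lemma openin_saturated_topology_iff:
  assumes "module.subspace s S" "vector_space s"
  shows "openin (saturated_topology T S) W \<longleftrightarrow>
    openin T W \<and> (\<forall>x\<in>W. \<forall>y. y - x \<in> S \<longrightarrow> y \<in> W)"
proof
  assume "openin (saturated_topology T S) W"
  then obtain V where "W = quotient_proj S -` V" "openin T W"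
    unfolding openin_saturated_topology by blast
  moreover have "y \<in> W" if "x \<in> W" "y - x \<in> S" for x y
    using that quotient_proj_eq_iff[OF assms, of y x] \<open>W = _\<close> by simp
  ultimately show "openin T W \<and> (\<forall>x\<in>W. \<forall>y. y - x \<in> S \<longrightarrow> y \<in> W)"
    by blast
next
  assume W: "openin T W \<and> (\<forall>x\<in>W. \<forall>y. y - x \<in> S \<longrightarrow> y \<in> W)"
  have "y \<in> W" if "x \<in> W" "quotient_proj S y = quotient_proj S x" for x y
    using that W quotient_proj_eq_iff[OF assms, of y x] by blast
  then have "W = quotient_proj S -` quotient_proj S ` W"
    by (auto simp: image_iff)
  with W show "openin (saturated_topology T S) W"
    unfolding openin_saturated_topology by (meson image_mono subset_UNIV)
qed

text \<open>Of the tensor product only the map \<open>tensor 1\<close> is retained. Both spaces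
  share the index set \<open>B\<close>, and coordinates correspond under \<iota>, so this map is
  isometric for the two norms.\<close>

locale completed_space =
  X: valued_coordinates sX \<nu> B eX cX + Y: valued_coordinates sY \<mu> B eY cY
  for sX :: "'k::field \<Rightarrow> 'x::ab_group_add \<Rightarrow> 'x" and \<nu> :: "'k \<Rightarrow> real"
    and sY :: "'l::field \<Rightarrow> 'y::ab_group_add \<Rightarrow> 'y" and \<mu> :: "'l \<Rightarrow> real"
    and B :: "'b set" and eX cX eY cY +
  fixes \<iota> :: "'k \<Rightarrow> 'l" and tensor :: "'l \<Rightarrow> 'x \<Rightarrow> 'y"
  assumes val_embed [simp]: "\<mu> (\<iota> k) = \<nu> k"
    and embed_dense: "r > 0 \<Longrightarrow> \<exists>k. \<mu> (\<iota> k - a) < r"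
    and tensor_add: "tensor 1 (x + y) = tensor 1 x + tensor 1 y"
    and tensor_scale: "tensor 1 (sX k x) = sY (\<iota> k) (tensor 1 x)"
    and tensor_basis: "b \<in> B \<Longrightarrow> tensor 1 (eX b) = eY b"
    and coord_tensor: "b \<in> B \<Longrightarrow> cY b (tensor 1 x) = \<iota> (cX b x)"
    and nontrivial: "nontrivial_valuation \<nu>"
    and locally_compact: "locally_compact_space (val_topology \<mu>)"
begin

abbreviation I :: "'x \<Rightarrow> 'y" where
  "I \<equiv> tensor 1"

lemma I_diff: "I (x - y) = I x - I y"
  using tensor_add[of "x - y" y] by simp

lemma I_zero [simp]: "I 0 = 0"
  using I_diff[of 0 0] by simp

lemma N_I [simp]: "Y.N (I x) = X.N x"
  by (simp add: X.N_def Y.N_def coord_tensor)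

text \<open>Each coordinate of \<open>y\<close> is approximated by the image of a scalar of the
  small field, and these scalars are the coefficients of the approximating vector.\<close>

lemma I_dense:
  assumes "r > 0" shows "\<exists>x. Y.N (I x - y) < r"
proof -
  \<comment> \<open>The extra 1 makes \<open>C\<close> positive and turns the final bound r / C * (C
    - 1) into a strict one.\<close>
  define C where "C = 1 + (\<Sum>b\<in>B. Y.N (eY b))"
  have C: "C > 0"
    using sum_nonneg[of B "\<lambda>b. Y.N (eY b)"] by (simp add: C_def add_pos_nonneg)
  with assms have "r / C > 0"
    by simp
  then have "\<forall>b. \<exists>k. \<mu> (\<iota> k - cY b y) < r / C"
    using embed_dense by blast
  then obtain k where k: "\<And>b. \<mu> (\<iota> (k b) - cY b y) < r / C"
    by metis
  have I_sum: "I (\<Sum>b\<in>A. sX (k b) (eX b)) = (\<Sum>b\<in>A. sY (\<iota> (k b)) (eY b))" if "A \<subseteq> B" for A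
    using that by (induction A rule: infinite_finite_induct) (auto simp: tensor_add tensor_scale tensor_basis)
  have "I (\<Sum>b\<in>B. sX (k b) (eX b)) - y = (\<Sum>b\<in>B. sY (\<iota> (k b) - cY b y) (eY b))"
    by (simp add: I_sum Y.scale_left_diff_distrib sum_subtractf Y.expansion)
  then have "Y.N (I (\<Sum>b\<in>B. sX (k b) (eX b)) - y) \<le> (\<Sum>b\<in>B. \<mu> (\<iota> (k b) - cY b y) * Y.N (eY b))"
    using Y.N_sum[of "\<lambda>b. sY (\<iota> (k b) - cY b y) (eY b)" B] by (simp add: Y.N.seminorm_scale)
  also have "\<dots> \<le> (\<Sum>b\<in>B. r / C * Y.N (eY b))"
    using k by (intro sum_mono mult_right_mono) (auto intro: less_imp_le)
  also have "\<dots> = r / C * (C - 1)"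
    by (simp add: C_def sum_distrib_left)
  also have "\<dots> < r"
    using C assms by (simp add: field_simps)
  finally show ?thesis
    by blast
qed

section \<open>Elementary properties of \<open>F_hat\<close> and \<open>G_hat\<close>\<close>

lemma mem_F_hat:
  "y \<in> F_hat \<mu> sY tensor T \<longleftrightarrow>
    (\<forall>U r. openin T U \<longrightarrow> 0 \<in> U \<longrightarrow> r > 0 \<longrightarrow> (\<exists>x\<in>U. Y.N (I x - y) < r))"
  by (auto simp: F_hat_def Y.max_compatible_topology_eq Y.N.seminorm_closure_of)

lemma F_hat_antimono:
  assumes "topology_subset T T'"
  shows "F_hat \<mu> sY tensor T' \<subseteq> F_hat \<mu> sY tensor T"
proof -
  have "openin T' U" if "openin T U" for U
    using assms that by (auto simp: topology_subset_def)
  then show ?thesis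
    unfolding subset_iff mem_F_hat by blast
qed

lemma subspace_F_hat:
  assumes "T \<in> compatible_topologies (val_topology \<nu>) sX"
  shows "Y.subspace (F_hat \<mu> sY tensor T)"
proof -
  interpret T: compatible_topology sX \<nu> T
    using assms by unfold_locales
  show ?thesis
    unfolding Y.subspace_def
  proof (intro conjI ballI allI)
    show "0 \<in> F_hat \<mu> sY tensor T"
      unfolding mem_F_hat by (auto intro!: bexI[of _ 0])
  next
    fix x y assume xy: "x \<in> F_hat \<mu> sY tensor T" "y \<in> F_hat \<mu> sY tensor T"
    show "x + y \<in> F_hat \<mu> sY tensor T"
      unfolding mem_F_hat
    proof (intro allI impI)
      fix U and r :: real assume "openin T U" "0 \<in> U" "r > 0"
      then obtain V where V: "openin T V" "0 \<in> V" "\<And>x y. x \<in> V \<Longrightarrow> y \<in> V \<Longrightarrow> x + y \<in> U"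
        using T.zero_nbhd_sum by metis
      have "r/2 > 0"
        using \<open>r > 0\<close> by simp
      with xy V(1,2) obtain u v where uv: "u \<in> V" "Y.N (I u - x) < r/2" "v \<in> V" "Y.N (I v - y) < r/2"
        unfolding mem_F_hat by blast
      have eq: "I (u + v) - (x + y) = (I u - x) + (I v - y)"
        by (simp add: tensor_add)
      have "Y.N (I (u + v) - (x + y)) < r"
        unfolding eq using Y.N.seminorm_add[of "I u - x" "I v - y"] uv by linarith
      then show "\<exists>z\<in>U. Y.N (I z - (x + y)) < r"
        using V(3) uv by blast
    qed
  next
    fix a x assume x: "x \<in> F_hat \<mu> sY tensor T"
    show "sY a x \<in> F_hat \<mu> sY tensor T"
      unfolding mem_F_hat
    proof (intro allI impI)
      fix U and r :: real assume U: "openin T U" "0 \<in> U" and "r > 0"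
      have pos: "Y.N x + 1 > 0"
        using Y.N.seminorm_nonneg[of x] by linarith
      with \<open>r > 0\<close> have pos2: "r/2 / (Y.N x + 1) > 0"
        by (intro divide_pos_pos) auto
      \<comment> \<open>The scalar \<open>a\<close> need not come from the small field, so
        \<open>T\<close> cannot be scaled by it directly. It is replaced by a nearby
        \<open>k\<close>; the error against \<open>x\<close> is controlled first, and then
        \<open>U\<close> is pulled back along scaling by the fixed \<open>k\<close>.\<close>
      obtain k where k: "\<mu> (\<iota> k - a) < r/2 / (Y.N x + 1)"
        using embed_dense[OF pos2] by blast
      have pos': "\<nu> k + 1 > 0"
        using X.val_nonneg[of k] by linarith
      with \<open>r > 0\<close> have pos2': "r/2 / (\<nu> k + 1) > 0"
        by (intro divide_pos_pos) auto
      have "openin T {y. sX k y \<in> U}" "0 \<in> {y. sX k y \<in> U}"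
        using T.openin_scale_preimage[OF U(1)] U(2) by auto
      with x pos2' obtain u where u: "sX k u \<in> U" "Y.N (I u - x) < r/2 / (\<nu> k + 1)"
        unfolding mem_F_hat by blast
      have "I (sX k u) - sY a x = sY (\<iota> k) (I u - x) + sY (\<iota> k - a) x"
        by (simp add: tensor_scale Y.scale_left_diff_distrib Y.scale_right_diff_distrib)
      then have "Y.N (I (sX k u) - sY a x) \<le> \<nu> k * Y.N (I u - x) + \<mu> (\<iota> k - a) * Y.N x"
        by (metis Y.N.seminorm_add Y.N.seminorm_scale val_embed)
      moreover have "\<nu> k * Y.N (I u - x) \<le> (\<nu> k + 1) * Y.N (I u - x)"
        by (simp add: algebra_simps)
      moreover have "(\<nu> k + 1) * Y.N (I u - x) < r/2"
        using u(2) pos' by (metis mult.commute pos_less_divide_eq)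
      moreover have "\<mu> (\<iota> k - a) * Y.N x \<le> \<mu> (\<iota> k - a) * (Y.N x + 1)"
        by (simp add: algebra_simps)
      moreover have "\<mu> (\<iota> k - a) * (Y.N x + 1) < r/2"
        using k pos by (metis pos_less_divide_eq)
      ultimately show "\<exists>z\<in>U. Y.N (I z - sY a x) < r"
        using u(1) by (intro bexI[of _ "sX k u"]) auto
    qed
  qed
qed

text \<open>Stability under translation by \<open>S'\<close> implies stability under translation by
  the smaller \<open>S\<close>.\<close>

lemma G_hat_antimono:
  assumes "Y.subspace S" "Y.subspace S'" "S \<subseteq> S'"
  shows "topology_subset (G_hat \<mu> sY tensor S') (G_hat \<mu> sY tensor S)"
  using assms(3)
  unfolding topology_subset_def G_hat_def openin_pullback_topology
    openin_saturated_topology_iff[OF assms(1) Y.vector_space_axioms]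
    openin_saturated_topology_iff[OF assms(2) Y.vector_space_axioms]
  by blast

end

section \<open>The two maps relative to a projection with kernel \<open>S\<close>\<close>

locale completed_space_projection = completed_space +
  fixes S P
  assumes P_linear: "Vector_Spaces.linear sY sY P"
    and P_eq_0: "P y = 0 \<longleftrightarrow> y \<in> S"
    and P_idem: "P (P y) = P y"
begin

sublocale P: Vector_Spaces.linear sY sY P
  by (rule P_linear)

text \<open>Since \<open>P\<close> has kernel \<open>S\<close>, the seminorm \<open>N \<circ> P\<close> replaces the quotient norm modulo \<open>S\<close>.\<close>

definition q where
  "q x = Y.N (P (I x))"

sublocale q: valuation_seminorm sX \<nu> q
proof
  show "q (x + y) \<le> q x + q y" for x y
    by (simp add: q_def tensor_add P.add Y.N.seminorm_add)
  show "q (sX a x) = \<nu> a * q x" for a x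
    by (simp add: q_def tensor_scale P.scale Y.N.seminorm_scale)
qed

lemma diff_P: "y - P y \<in> S"
  unfolding P_eq_0[symmetric] by (simp add: P.diff P_idem)

lemma subspace_S: "Y.subspace S"
  using P.subspace_kernel by (simp add: P_eq_0)

lemma P_diff_S: "y - x \<in> S \<Longrightarrow> P y = P x"
  using P_eq_0[of "y - x"] by (simp add: P.diff)

lemma openin_P_ball: "openin (seminorm_topology Y.N) {y. Y.N (P y - z) < r}"
  unfolding openin_seminorm_topology
proof safe
  fix x assume x: "Y.N (P x - z) < r"
  obtain C where C: "C > 0" "\<And>x. Y.N (P x) \<le> C * Y.N x"
    using Y.linear_bound[OF P_linear] by blast
  let ?d = "r - Y.N (P x - z)"
  have "Y.N (P y - z) < r" if "Y.N (y - x) < ?d / C" for y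
  proof -
    have "C * Y.N (y - x) < ?d"
      using that C(1) by (metis mult.commute pos_less_divide_eq)
    then have "Y.N (P y - P x) < ?d"
      using C(2)[of "y - x"] by (simp add: P.diff)
    then show ?thesis
      using Y.N.seminorm_triangle[of "P y" z "P x"] by simp
  qed
  then show "\<exists>d>0. \<forall>y. Y.N (y - x) < d \<longrightarrow> y \<in> {y. Y.N (P y - z) < r}"
    using C(1) x by (intro exI[of _ "?d / C"]) auto
qed

text \<open>Modulo \<open>S\<close> a vector may be replaced by its projection, so an open set
  stable under \<open>S\<close> sees only the size of the projection. Conversely, balls measured
  after \<open>P\<close> are open, because \<open>P\<close> is bounded, and stable under
  \<open>S\<close>.\<close>

lemma G_hat_eq: "G_hat \<mu> sY tensor S = seminorm_topology q"
proof (rule seminorm_topology_eqI)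
  fix U
  show "openin (G_hat \<mu> sY tensor S) U \<longleftrightarrow> (\<forall>x\<in>U. \<exists>r>0. \<forall>y. q (y - x) < r \<longrightarrow> y \<in> U)"
    unfolding G_hat_def openin_pullback_topology Y.max_compatible_topology_eq
      openin_saturated_topology_iff[OF subspace_S Y.vector_space_axioms]
  proof
    assume "\<exists>W. (openin (seminorm_topology Y.N) W \<and> (\<forall>x\<in>W. \<forall>y. y - x \<in> S \<longrightarrow> y \<in> W)) \<and>
      U = I -` W \<inter> UNIV"
    then obtain W where W: "openin (seminorm_topology Y.N) W" "\<And>x y. x \<in> W \<Longrightarrow> y - x \<in> S \<Longrightarrow> y \<in> W"
      "U = I -` W"
      by auto
    show "\<forall>x\<in>U. \<exists>r>0. \<forall>y. q (y - x) < r \<longrightarrow> y \<in> U"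
    proof
      fix x assume "x \<in> U"
      then obtain r where r: "r > 0" "\<And>z. Y.N (z - I x) < r \<Longrightarrow> z \<in> W"
        using W(1,3) unfolding openin_seminorm_topology by blast
      have "y \<in> U" if "q (y - x) < r" for y
      proof -
        \<comment> \<open>This point differs from \<open>I x\<close> by a vector of norm q (y - x),
          and from \<open>I y\<close> by an element of \<open>S\<close>.\<close>
        have "I x + P (I (y - x)) \<in> W"
          using r(2)[of "I x + P (I (y - x))"] that by (simp add: q_def)
        moreover have "I y - (I x + P (I (y - x))) \<in> S"
          using diff_P[of "I (y - x)"] by (simp add: I_diff algebra_simps)
        ultimately show ?thesis
          using W(2,3) by blast
      qed
      then show "\<exists>r>0. \<forall>y. q (y - x) < r \<longrightarrow> y \<in> U"
        using r(1) by blast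
    qed
  next
    assume U: "\<forall>x\<in>U. \<exists>r>0. \<forall>y. q (y - x) < r \<longrightarrow> y \<in> U"
    \<comment> \<open>The preimages under \<open>I\<close> of these \<open>P\<close>-balls are
      \<open>q\<close>-balls contained in \<open>U\<close>. The radii carry no sign condition: for r
      \<le> 0 the balls are empty.\<close>
    define W where "W = (\<Union>(x, r)\<in>{(x, r). \<forall>y. q (y - x) < r \<longrightarrow> y \<in> U}. {z. Y.N (P z - P (I x)) < r})"
    have "openin (seminorm_topology Y.N) W"
      unfolding W_def by (rule openin_Union) (auto intro: openin_P_ball)
    moreover have "z \<in> W" if "y \<in> W" "z - y \<in> S" for y z
      using that(1) unfolding W_def by (simp add: P_diff_S[OF that(2)])
    moreover have "U = I -` W"
    proof
      show "I -` W \<subseteq> U"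
        by (auto simp: W_def q_def I_diff P.diff)
      show "U \<subseteq> I -` W"
      proof
        fix x assume "x \<in> U"
        with U obtain r where "r > 0" "\<forall>y. q (y - x) < r \<longrightarrow> y \<in> U"
          by blast
        then show "x \<in> I -` W"
          unfolding W_def by force
      qed
    qed
    ultimately show "\<exists>W. (openin (seminorm_topology Y.N) W \<and> (\<forall>x\<in>W. \<forall>y. y - x \<in> S \<longrightarrow> y \<in> W)) \<and>
      U = I -` W \<inter> UNIV"
      by (intro exI[of _ W]) auto
  qed
qed

lemma G_hat_compatible: "G_hat \<mu> sY tensor S \<in> compatible_topologies (val_topology \<nu>) sX"
  unfolding G_hat_eq by (rule q.seminorm_topology_compatible)

text \<open>For \<open>y\<close> in \<open>S\<close> one has P (I x) = P (I x - y), so vectors whose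
  images approximate \<open>y\<close> have small \<open>q\<close>. Conversely, a point of
  \<open>F_hat\<close> is a limit of images \<open>I x\<close> with \<open>q x\<close> tending to 0,
  which forces P y = 0.\<close>

lemma F_hat_G_hat: "F_hat \<mu> sY tensor (G_hat \<mu> sY tensor S) = S"
proof -
  obtain C where C: "C > 0" "\<And>x. Y.N (P x) \<le> C * Y.N x"
    using Y.linear_bound[OF P_linear] by blast
  show ?thesis
    unfolding G_hat_eq
  proof
    show "S \<subseteq> F_hat \<mu> sY tensor (seminorm_topology q)"
    proof
      fix y assume y: "y \<in> S"
      show "y \<in> F_hat \<mu> sY tensor (seminorm_topology q)"
        unfolding mem_F_hat
      proof (intro allI impI)
        fix U and r :: real assume "openin (seminorm_topology q) U" "0 \<in> U" and r: "r > 0"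
        then obtain d where d: "d > 0" "\<And>x. q x < d \<Longrightarrow> x \<in> U"
          unfolding openin_seminorm_topology by fastforce
        have "min r (d / C) > 0"
          using r d(1) C(1) by simp
        from I_dense[OF this, of y] obtain x where x: "Y.N (I x - y) < r" "Y.N (I x - y) < d / C"
          by auto
        have "C * Y.N (I x - y) < d"
          using x(2) C(1) by (metis mult.commute pos_less_divide_eq)
        moreover have "P (I x - y) = P (I x)"
          using y P_eq_0[of y] by (simp add: P.diff)
        ultimately have "q x < d"
          using C(2)[of "I x - y"] by (simp add: q_def)
        then show "\<exists>x\<in>U. Y.N (I x - y) < r"
          using d(2) x(1) by blast
      qed
    qed
    show "F_hat \<mu> sY tensor (seminorm_topology q) \<subseteq> S"
    proof
      fix y assume y: "y \<in> F_hat \<mu> sY tensor (seminorm_topology q)"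
      have "Y.N (P y) \<le> 0 + r" if r: "r > 0" for r
      proof -
        have "r / 2 > 0" "r / (2 * C) > 0"
          using r C(1) by auto
        then obtain x where x: "q x < r / 2" "Y.N (I x - y) < r / (2 * C)"
          using y q.openin_seminorm_ball[of 0 "r / 2"] unfolding mem_F_hat by fastforce
        have "C * Y.N (I x - y) < r / 2"
          using x(2) C(1) by (simp add: pos_less_divide_eq mult.commute mult.left_commute)
        then have "Y.N (P (I x) - P y) < r / 2"
          using C(2)[of "I x - y"] by (simp add: P.diff)
        then show ?thesis
          using x(1) Y.N.seminorm_diff[of "P (I x)" "P (I x) - P y"] by (simp add: q_def)
      qed
      then have "Y.N (P y) \<le> 0"
        by (rule field_le_epsilon)
      then have "P y = 0"
        using Y.N_pos[of "P y"] by linarith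
      then show "y \<in> S"
        by (simp add: P_eq_0)
    qed
  qed
qed

text \<open>The part I x - P (I x) lies in \<open>S\<close>, hence is approximated by
  \<open>I u\<close> with \<open>u\<close> in \<open>V\<close>. The remainder x - u then has small
  norm and also lies in \<open>V\<close>, as \<open>T\<close> is coarser than the norm
  topology.\<close>

lemma zero_nbhd_contains_q_ball:
  assumes T: "T \<in> compatible_topologies (val_topology \<nu>) sX"
    and S: "S = F_hat \<mu> sY tensor T"
    and U: "openin T U" "0 \<in> U"
  shows "\<exists>r>0. \<forall>x. q x < r \<longrightarrow> x \<in> U"
proof -
  interpret T: compatible_topology sX \<nu> T
    using T by unfold_locales
  obtain V where V: "openin T V" "0 \<in> V" "\<And>x y. x \<in> V \<Longrightarrow> y \<in> V \<Longrightarrow> x + y \<in> U"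
    using T.zero_nbhd_sum[OF U] by metis
  obtain r where r: "r > 0" "\<And>x. X.N x < r \<Longrightarrow> x \<in> V"
    using X.openin_compatible_imp_openin_N[OF T V(1)] V(2)
    unfolding openin_seminorm_topology by fastforce
  have "x \<in> U" if "q x < r / 2" for x
  proof -
    have "I x - P (I x) \<in> F_hat \<mu> sY tensor T"
      using diff_P S by simp
    moreover have "r / 2 > 0"
      using r(1) by simp
    ultimately obtain u where u: "u \<in> V" "Y.N (I u - (I x - P (I x))) < r / 2"
      using V(1,2) unfolding mem_F_hat by blast
    have "I (x - u) = P (I x) - (I u - (I x - P (I x)))"
      by (simp add: I_diff)
    then have "X.N (x - u) \<le> Y.N (P (I x)) + Y.N (I u - (I x - P (I x)))"
      by (metis N_I Y.N.seminorm_diff)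
    then have "x - u \<in> V"
      using that u(2) by (intro r(2)) (simp add: q_def)
    then show ?thesis
      using V(3)[of "x - u" u] u(1) by simp
  qed
  then show ?thesis
    using r(1) by (intro exI[of _ "r / 2"]) auto
qed

text \<open>Compactness turns the separate neighbourhoods that keep \<open>I\<close> away from each
  point outside \<open>F_hat\<close> into a single one. A balanced neighbourhood inside it cannot
  reach the shell, hence stays in the \<open>q\<close>-ball.\<close>

lemma q_ball_contains_zero_nbhd:
  assumes T: "T \<in> compatible_topologies (val_topology \<nu>) sX"
    and S: "S = F_hat \<mu> sY tensor T"
    and r: "r > 0"
  shows "\<exists>V. openin T V \<and> 0 \<in> V \<and> (\<forall>x\<in>V. q x < r)"
proof -
  interpret T: compatible_topology sX \<nu> T
    using T by unfold_locales
  obtain p where p: "0 < \<nu> p" "\<nu> p < 1"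
    using X.nontrivial_obtains[OF nontrivial] .
  obtain C where C: "compactin (seminorm_topology Y.N) C" "{y. Y.N y \<le> r} \<subseteq> C"
    using Y.compact_N_ball[OF locally_compact, of "\<iota> p" r] p by auto
  \<comment> \<open>A vector outside the \<open>q\<close>-ball of radius \<open>r\<close> can be scaled into the \<open>q\<close>-shell between \<open>\<nu> p * r\<close>
    and \<open>r\<close>. Modulo \<open>S\<close> this shell is relatively compact and misses \<open>S = F T\<close>.\<close>
  define A where "A = {y. Y.N (P y) < \<nu> p * r}"
  \<comment> \<open>By \<open>mem_F_hat\<close>, each point outside \<open>F_hat\<close> has a ball
    in this family, while points with small projection are covered by \<open>A\<close>.\<close>
  define \<D> where "\<D> = {D. openin (seminorm_topology Y.N) D \<and>
    (\<exists>U. openin T U \<and> 0 \<in> U \<and> (\<forall>x\<in>U. I x \<notin> D))}"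
  have "C \<subseteq> \<Union>(insert A \<D>)"
  proof
    fix y assume "y \<in> C"
    show "y \<in> \<Union>(insert A \<D>)"
    proof (cases "y \<in> A")
      case False
      then have "\<nu> p * r \<le> Y.N (P y)"
        by (simp add: A_def)
      with mult_pos_pos[OF p(1) r] have "0 < Y.N (P y)"
        by linarith
      then have "y \<notin> F_hat \<mu> sY tensor T"
        using P_eq_0[of y] S by auto
      then obtain U d where U: "openin T U" "0 \<in> U" "d > 0" "\<forall>x\<in>U. \<not> Y.N (I x - y) < d"
        unfolding mem_F_hat by blast
      then have "{z. Y.N (z - y) < d} \<in> \<D>"
        using Y.N.openin_seminorm_ball unfolding \<D>_def by blast
      moreover have "y \<in> {z. Y.N (z - y) < d}"
        using U(3) by simp
      ultimately show ?thesis
        by blast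
    qed simp
  qed
  moreover have "openin (seminorm_topology Y.N) D" if "D \<in> insert A \<D>" for D
    using that openin_P_ball[of 0 "\<nu> p * r"] by (auto simp: A_def \<D>_def)
  ultimately obtain \<F> where \<F>: "finite \<F>" "\<F> \<subseteq> insert A \<D>" "C \<subseteq> \<Union>\<F>"
    using C(1) unfolding compactin_def by meson
  have avoid: "\<exists>U. openin T U \<and> 0 \<in> U \<and> (\<forall>D\<in>\<F>'. \<forall>x\<in>U. I x \<notin> D)" if "finite \<F>'" "\<F>' \<subseteq> \<D>" for \<F>'
    using that
  proof induction
    case empty
    then show ?case
      by (metis UNIV_I T.topspace_compatible empty_iff openin_topspace)
  next
    case (insert D \<F>')
    then obtain U where "openin T U" "0 \<in> U" "\<forall>D\<in>\<F>'. \<forall>x\<in>U. I x \<notin> D"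
      by auto
    moreover obtain U' where "openin T U'" "0 \<in> U'" "\<forall>x\<in>U'. I x \<notin> D"
      using insert.prems by (auto simp: \<D>_def)
    ultimately show ?case
      by (intro exI[of _ "U \<inter> U'"]) auto
  qed
  obtain U where U: "openin T U" "0 \<in> U" "\<And>D x. D \<in> \<F> - {A} \<Longrightarrow> x \<in> U \<Longrightarrow> I x \<notin> D"
    using avoid[of "\<F> - {A}"] \<F> by (metis Diff_subset_conv finite_Diff insert_is_Un)
  \<comment> \<open>\<open>U\<close> is halved to leave room for a correction by an element of
    \<open>V\<close>; the balanced \<open>V'\<close> allows scaling into the shell without leaving
    \<open>V\<close>.\<close>
  obtain V where V: "openin T V" "0 \<in> V" "\<And>x y. x \<in> V \<Longrightarrow> y \<in> V \<Longrightarrow> x + y \<in> U"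
    using T.zero_nbhd_sum[OF U(1,2)] by metis
  obtain V' where V': "openin T V'" "0 \<in> V'" "V' \<subseteq> V" "\<And>a x. x \<in> V' \<Longrightarrow> \<nu> a \<le> 1 \<Longrightarrow> sX a x \<in> V'"
    using T.zero_nbhd_balanced[OF V(1,2) nontrivial] by metis
  have "q x < r" if x: "x \<in> V'" for x
  proof (rule ccontr)
    assume qx: "\<not> q x < r"
    then have "q x > 0"
      using r by linarith
    then have "r / q x > 0"
      using r by simp
    from real_arch_pow_inv[OF this p(2)] obtain n where "\<nu> p ^ n < r / q x"
      by blast
    then have n: "\<nu> p ^ n * q x < r"
      using \<open>q x > 0\<close> by (simp add: pos_less_divide_eq)
    \<comment> \<open>The first power that brings the vector below \<open>r\<close>. It is not the
      zeroth, and its predecessor still gives at least \<open>r\<close>, so one more factor \<nu> p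
      leaves at least \<nu> p * r.\<close>
    define m where "m = (LEAST n. \<nu> p ^ n * q x < r)"
    have m: "\<nu> p ^ m * q x < r"
      unfolding m_def using n by (rule LeastI)
    obtain l where l: "m = Suc l"
      using m qx by (cases m) auto
    have "\<not> \<nu> p ^ l * q x < r"
      using not_less_Least[of l "\<lambda>n. \<nu> p ^ n * q x < r"] l by (simp add: m_def)
    then have "\<nu> p * r \<le> \<nu> p ^ m * q x"
      using p(1) l by (simp add: mult.assoc mult_left_mono)
    define z where "z = sX (p ^ m) x"
    have qz: "\<nu> p * r \<le> q z" "q z < r"
      using m \<open>\<nu> p * r \<le> \<nu> p ^ m * q x\<close> by (auto simp: z_def q.seminorm_scale X.val_power)
    have "z \<in> V'"
      unfolding z_def using x p by (intro V'(4)) (auto simp: X.val_power power_le_one)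
    define y where "y = P (I z)"
    have "y \<in> C" "y \<notin> A"
      using qz C(2) by (auto simp: y_def A_def q_def P_idem)
    then obtain D where D: "D \<in> \<F> - {A}" "y \<in> D"
      using \<F>(3) by blast
    then have "openin (seminorm_topology Y.N) D"
      using \<F>(2) by (auto simp: \<D>_def)
    with D(2) obtain d where d: "d > 0" "\<And>w. Y.N (w - y) < d \<Longrightarrow> w \<in> D"
      unfolding openin_seminorm_topology by blast
    \<comment> \<open>Since \<open>y\<close> and \<open>I z\<close> agree modulo \<open>S\<close>,
      their difference is approximated by some \<open>I v\<close> with \<open>v\<close> in
      \<open>V\<close>. Thus I (z + v) comes close to \<open>y\<close> and enters \<open>D\<close>,
      although z + v lies in \<open>U\<close>.\<close>
    have "- (I z - P (I z)) \<in> S"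
      using diff_P Y.subspace_neg[OF subspace_S] by blast
    then have "y - I z \<in> F_hat \<mu> sY tensor T"
      using S by (simp add: y_def)
    then obtain v where v: "v \<in> V" "Y.N (I v - (y - I z)) < d"
      using V(1,2) d(1) unfolding mem_F_hat by blast
    have "I v - (y - I z) = I (z + v) - y"
      by (simp add: tensor_add)
    with v(2) have "I (z + v) \<in> D"
      using d(2) by simp
    moreover have "z + v \<in> U"
      using V(3) V'(3) \<open>z \<in> V'\<close> v(1) by blast
    ultimately show False
      using U(3) D(1) by blast
  qed
  then show ?thesis
    using V'(1,2) by blast
qed

lemma G_hat_F_hat:
  assumes T: "T \<in> compatible_topologies (val_topology \<nu>) sX"
    and S: "S = F_hat \<mu> sY tensor T"
  shows "G_hat \<mu> sY tensor S = T"
proof -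
  interpret T: compatible_topology sX \<nu> T
    using T by unfold_locales
  have "T = seminorm_topology q"
  proof (rule seminorm_topology_eqI)
    fix U
    show "openin T U \<longleftrightarrow> (\<forall>x\<in>U. \<exists>r>0. \<forall>y. q (y - x) < r \<longrightarrow> y \<in> U)"
    proof (subst T.openin_iff_zero_nbhd, intro ball_cong refl iffI)
      fix x assume "\<exists>V. openin T V \<and> 0 \<in> V \<and> (\<forall>y\<in>V. x + y \<in> U)"
      then obtain V where V: "openin T V" "0 \<in> V" "\<And>y. y \<in> V \<Longrightarrow> x + y \<in> U"
        by blast
      obtain r where r: "r > 0" "\<And>x. q x < r \<Longrightarrow> x \<in> V"
        using zero_nbhd_contains_q_ball[OF T S V(1,2)] by blast
      have "y \<in> U" if "q (y - x) < r" for y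
        using V(3)[OF r(2)[OF that]] by simp
      then show "\<exists>r>0. \<forall>y. q (y - x) < r \<longrightarrow> y \<in> U"
        using r(1) by blast
    next
      fix x assume "\<exists>r>0. \<forall>y. q (y - x) < r \<longrightarrow> y \<in> U"
      then obtain r where r: "r > 0" "\<And>y. q (y - x) < r \<Longrightarrow> y \<in> U"
        by blast
      obtain V where V: "openin T V" "0 \<in> V" "\<And>y. y \<in> V \<Longrightarrow> q y < r"
        using q_ball_contains_zero_nbhd[OF T S r(1)] by blast
      have "x + y \<in> U" if "y \<in> V" for y
        using r(2)[of "x + y"] V(3)[OF that] by simp
      then show "\<exists>V. openin T V \<and> 0 \<in> V \<and> (\<forall>y\<in>V. x + y \<in> U)"
        using V(1,2) by blast
    qed
  qed
  then show ?thesis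
    by (simp add: G_hat_eq)
qed

end

section \<open>Coordinates on the extension of scalars\<close>

text \<open>The additive extension of \<open>f\<close> from the generators to the free abelian
  group, used to define maps out of the tensor product by their values on pairs.\<close>

definition free_extend :: "('p \<Rightarrow> 'l::comm_ring_1) \<Rightarrow> ('p \<Rightarrow>\<^sub>0 int) \<Rightarrow> 'l" where
  "free_extend f z = (\<Sum>p\<in>Poly_Mapping.keys z. of_int (Poly_Mapping.lookup z p) * f p)"

lemma free_extend_superset:
  assumes "finite A" "Poly_Mapping.keys z \<subseteq> A"
  shows "free_extend f z = (\<Sum>p\<in>A. of_int (Poly_Mapping.lookup z p) * f p)"
  unfolding free_extend_def using assms by (intro sum.mono_neutral_left) (auto simp: in_keys_iff)

lemma free_extend_diff: "free_extend f (z - w) = free_extend f z - free_extend f w"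
proof -
  let ?A = "Poly_Mapping.keys z \<union> Poly_Mapping.keys w"
  have "Poly_Mapping.keys (z - w) \<subseteq> ?A"
    by (rule keys_diff)
  then show ?thesis
    by (simp add: free_extend_superset[of ?A] lookup_minus algebra_simps sum_subtractf)
qed

lemma free_extend_zero [simp]: "free_extend f 0 = 0"
  by (simp add: free_extend_def)

lemma free_extend_single [simp]: "free_extend f (Poly_Mapping.single p 1) = f p"
  by (simp add: free_extend_def)

section \<open>Scalar extension through the tensor relations\<close>

locale field_extension_of_scalars =
  X: vector_space sX + Y: vector_space sY
  for sX :: "'k::field \<Rightarrow> 'x::ab_group_add \<Rightarrow> 'x" and sY :: "'l::field \<Rightarrow> 'y::ab_group_add \<Rightarrow> 'y" +
  fixes \<iota> :: "'k \<Rightarrow> 'l" and tensor :: "'l \<Rightarrow> 'x \<Rightarrow> 'y"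
  assumes embed_add: "\<iota> (a + b) = \<iota> a + \<iota> b"
    and embed_mult: "\<iota> (a * b) = \<iota> a * \<iota> b"
    and scalar_extension: "scalar_extension \<iota> sX sY tensor"
begin

definition \<phi> where
  "\<phi> = (SOME \<phi>. Modules.additive \<phi> \<and> (\<forall>a x. \<phi> (Poly_Mapping.single (a, x) 1) = tensor a x) \<and>
    surj \<phi> \<and> {z. \<phi> z = 0} = tensor_relations \<iota> sX)"

lemma \<phi>: "Modules.additive \<phi>" "\<phi> (Poly_Mapping.single (a, x) 1) = tensor a x" "surj \<phi>"
    "\<phi> z = 0 \<longleftrightarrow> z \<in> tensor_relations \<iota> sX"
proof -
  have "\<exists>\<phi>. Modules.additive \<phi> \<and> (\<forall>a x. \<phi> (Poly_Mapping.single (a, x) 1) = tensor a x) \<and>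
    surj \<phi> \<and> {z. \<phi> z = 0} = tensor_relations \<iota> sX"
    using scalar_extension by (simp add: scalar_extension_def)
  from someI_ex[OF this, folded \<phi>_def]
  show "Modules.additive \<phi>" "\<phi> (Poly_Mapping.single (a, x) 1) = tensor a x" "surj \<phi>"
    "\<phi> z = 0 \<longleftrightarrow> z \<in> tensor_relations \<iota> sX"
    by auto
qed

sublocale \<phi>: additive \<phi>
  by (rule \<phi>(1))

lemma scale_tensor: "sY a (tensor b x) = tensor (a * b) x"
  using scalar_extension by (simp add: scalar_extension_def)

lemma tensor_add_right: "tensor a (x + y) = tensor a x + tensor a y"
proof -
  have "Poly_Mapping.single (a, x + y) 1 - Poly_Mapping.single (a, x) 1 - Poly_Mapping.single (a, y) 1
      \<in> tensor_relations \<iota> sX"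
    unfolding tensor_relations_def by (intro group_closure.base) blast
  then show ?thesis
    unfolding \<phi>(4)[symmetric] \<phi>.diff \<phi>(2) by (simp add: algebra_simps)
qed

lemma tensor_balanced: "tensor (a * \<iota> c) x = tensor a (sX c x)"
proof -
  have "Poly_Mapping.single (a * \<iota> c, x) 1 - Poly_Mapping.single (a, sX c x) 1 \<in> tensor_relations \<iota> sX"
    unfolding tensor_relations_def by (intro group_closure.base) blast
  then show ?thesis
    unfolding \<phi>(4)[symmetric] \<phi>.diff \<phi>(2) by simp
qed

text \<open>Every vector is the image under \<phi> of an element of the free abelian group, and that
  group is generated from single pairs by subtraction.\<close>

lemma tensor_induct [case_names zero tensor diff]:
  assumes "Q 0" "\<And>a x. Q (tensor a x)" "\<And>x y. Q x \<Longrightarrow> Q y \<Longrightarrow> Q (x - y)"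
  shows "Q y"
proof -
  obtain z where "y = \<phi> z"
    using \<phi>(3) by (metis surjD)
  moreover have "Q (\<phi> z)"
    using subset_UNIV
  proof (induction z rule: frag_induction)
    case (one p)
    obtain a x where "p = (a, x)"
      by (rule prod.exhaust)
    then show ?case
      using assms(2) \<phi>(2) by simp
  qed (use assms in \<open>auto simp: \<phi>.zero \<phi>.diff\<close>)
  ultimately show ?thesis
    by simp
qed

text \<open>An instance of the universal property: the assignment of a * \<iota> (g x) to (a, x)
  respects all three kinds of tensor relations, so its additive extension factors through
  \<phi>.\<close>

lemma functional_extends:
  assumes g_add: "\<And>x y. g (x + y) = g x + g y" and g_scale: "\<And>a x. g (sX a x) = a * g x"
  obtains h where "\<And>x y. h (x + y) = h x + h y" "\<And>a x. h (sY a x) = a * h x"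
    "\<And>a x. h (tensor a x) = a * \<iota> (g x)"
proof -
  define \<psi> where "\<psi> = free_extend (\<lambda>(a, x). a * \<iota> (g x))"
  \<comment> \<open>The value is read off a chosen preimage under \<phi>; two preimages differ by a
    tensor relation, which \<psi> kills.\<close>
  define h where "h y = \<psi> (SOME z. \<phi> z = y)" for y
  have kernel: "\<psi> z = 0" if "z \<in> tensor_relations \<iota> sX" for z
    using that unfolding tensor_relations_def
    by induction
      (auto simp: \<psi>_def free_extend_diff g_add g_scale embed_add embed_mult ring_distribs)
  have h: "h (\<phi> z) = \<psi> z" for z
  proof -
    define w where "w = (SOME w. \<phi> w = \<phi> z)"
    have "\<phi> w = \<phi> z"
      unfolding w_def by (rule someI[of _ z]) simp
    then have "\<phi> (w - z) = 0"
      by (simp add: \<phi>.diff)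
    then have "\<psi> (w - z) = 0"
      using kernel \<phi>(4) by blast
    then show ?thesis
      by (simp add: h_def w_def \<psi>_def free_extend_diff)
  qed
  have h_diff: "h (x - y) = h x - h y" for x y
  proof -
    obtain z w where "x = \<phi> z" "y = \<phi> w"
      using \<phi>(3) by (metis surjD)
    then show ?thesis
      by (simp add: h \<phi>.diff[symmetric]) (simp add: \<psi>_def free_extend_diff)
  qed
  have h_zero: "h 0 = 0"
    using h_diff[of 0 0] by simp
  have h_tensor: "h (tensor a x) = a * \<iota> (g x)" for a x
    using h[of "Poly_Mapping.single (a, x) 1"] by (simp add: \<phi>(2) \<psi>_def)
  show ?thesis
  proof (rule that[OF _ _ h_tensor])
    show "h (x + y) = h x + h y" for x y
      using h_diff[of x "- y"] h_diff[of 0 y] h_zero by simp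
    show "h (sY a y) = a * h y" for a y
      by (induction y rule: tensor_induct)
        (auto simp: h_zero h_tensor h_diff scale_tensor Y.scale_right_diff_distrib algebra_simps)
  qed
qed

text \<open>The expansion is checked on pure tensors, where balancedness moves the old coordinates
  to the right factor and reduces it to the expansion in the original space.\<close>

lemma valued_coordinates_extend:
  assumes X: "valued_coordinates sX \<nu> B eX cX" and \<mu>: "valuation \<mu>"
  obtains cY where "valued_coordinates sY \<mu> B (\<lambda>b. tensor 1 (eX b)) cY"
    "\<And>b x. cY b (tensor 1 x) = \<iota> (cX b x)"
proof -
  interpret VX: valued_coordinates sX \<nu> B eX cX
    by fact
  have "\<exists>h. (\<forall>x y. h (x + y) = h x + h y) \<and> (\<forall>a x. h (sY a x) = a * h x) \<and>
      (\<forall>a x. h (tensor a x) = a * \<iota> (cX b x))" for b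
    using functional_extends[of "cX b"] VX.coord_add VX.coord_scale by metis
  then obtain cY where cY: "\<And>b x y. cY b (x + y) = cY b x + cY b y"
    "\<And>b a x. cY b (sY a x) = a * cY b x" "\<And>b a x. cY b (tensor a x) = a * \<iota> (cX b x)"
    by metis
  have cY_diff: "cY b (x - y) = cY b x - cY b y" for b x y
    using cY(1)[of b "x - y" y] by simp
  have cY_zero: "cY b 0 = 0" for b
    using cY_diff[of b 0 0] by simp
  have tensor_zero: "tensor a 0 = 0" for a
    using tensor_add_right[of a 0 0] by simp
  have tensor_sum: "tensor a (\<Sum>b\<in>A. f b) = (\<Sum>b\<in>A. tensor a (f b))" for a A and f :: "'b \<Rightarrow> 'x"
    by (induction A rule: infinite_finite_induct) (auto simp: tensor_add_right tensor_zero)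
  have "(\<Sum>b\<in>B. sY (cY b y) (tensor 1 (eX b))) = y" for y
  proof (induction y rule: tensor_induct)
    case (tensor a x)
    have "(\<Sum>b\<in>B. sY (cY b (tensor a x)) (tensor 1 (eX b))) = (\<Sum>b\<in>B. tensor a (sX (cX b x) (eX b)))"
      by (simp add: cY(3) tensor_balanced scale_tensor)
    also have "\<dots> = tensor a x"
      by (simp add: VX.expansion tensor_sum[symmetric])
    finally show ?case .
  next
    case (diff x y)
    then show ?case
      by (simp add: cY_diff Y.scale_left_diff_distrib sum_subtractf)
  qed (simp add: cY_zero)
  then have "valued_coordinates sY \<mu> B (\<lambda>b. tensor 1 (eX b)) cY"
    using \<mu> by unfold_locales (auto simp: cY VX.finite_B)
  then show ?thesis
    using that cY(3) by simp
qed

end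

lemma (in vector_space) finite_span_imp_valued_coordinates:
  assumes "finite A" "span A = UNIV" "valuation \<nu>"
  obtains B where "valued_coordinates scale \<nu> B (\<lambda>b. b) (\<lambda>b x. representation B x b)"
proof -
  obtain B where B: "B \<subseteq> A" "independent B" "A \<subseteq> span B"
    by (rule maximal_independent_subset)
  have span: "span B = UNIV"
    using span_mono[OF B(3)] assms(2) by (simp add: span_span top.extremum_unique)
  have "finite B"
    using B(1) assms(1) by (rule finite_subset)
  have "valued_coordinates scale \<nu> B (\<lambda>b. b) (\<lambda>b x. representation B x b)"
    using assms(3) \<open>finite B\<close> span
    by unfold_locales
      (auto simp: representation_add[OF B(2)] representation_scale[OF B(2)]
        sum_representation_eq[OF B(2)])
  then show ?thesis
    using that by blast
qed

section \<open>The correspondence for a given completion and scalar extension\<close>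

theorem theoremA:
  fixes \<nu> :: "'k::field \<Rightarrow> real" and \<mu> :: "'l::field \<Rightarrow> real" and \<iota> :: "'k \<Rightarrow> 'l"
    and sX :: "'k \<Rightarrow> 'x::ab_group_add \<Rightarrow> 'x"
    and sY :: "'l \<Rightarrow> 'y::ab_group_add \<Rightarrow> 'y"
    and tensor :: "'l \<Rightarrow> 'x \<Rightarrow> 'y"
    and \<tau> :: "'x topology set" and \<sigma> :: "'y set set"
    and F :: "'x topology \<Rightarrow> 'y set" and G :: "'y set \<Rightarrow> 'x topology"
  assumes "valuation \<nu>" and "nontrivial_valuation \<nu>"
    and "val_completion \<nu> \<mu> \<iota>"
    and "locally_compact_space (val_topology \<mu>)"
    and "vector_space sX" and "\<exists>B. finite B \<and> module.span sX B = UNIV"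
    and "scalar_extension \<iota> sX sY tensor"
  defines "\<tau> \<equiv> compatible_topologies (val_topology \<nu>) sX"
    and "\<sigma> \<equiv> {S. module.subspace sY S}"
    and "F \<equiv> F_hat \<mu> sY tensor"
    and "G \<equiv> G_hat \<mu> sY tensor"
  shows "F \<in> \<tau> \<rightarrow> \<sigma> \<and> G \<in> \<sigma> \<rightarrow> \<tau> \<and>
    (\<forall>T\<in>\<tau>. G (F T) = T) \<and> (\<forall>S\<in>\<sigma>. F (G S) = S) \<and>
    (\<forall>T\<in>\<tau>. \<forall>T'\<in>\<tau>. topology_subset T T' \<longrightarrow> F T' \<subseteq> F T) \<and>
    (\<forall>S\<in>\<sigma>. \<forall>S'\<in>\<sigma>. S \<subseteq> S' \<longrightarrow> topology_subset (G S') (G S))"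
proof -
  have completion: "valuation \<mu>" "\<iota> 1 = 1" "\<And>a b. \<iota> (a + b) = \<iota> a + \<iota> b"
    "\<And>a b. \<iota> (a * b) = \<iota> a * \<iota> b" "\<And>a. \<mu> (\<iota> a) = \<nu> a" "val_topology \<mu> closure_of range \<iota> = UNIV"
    using assms(3) by (auto simp: val_completion_def)
  interpret L: valuation_field \<mu>
    by unfold_locales (rule completion(1))
  interpret L: valuation_seminorm "(*)" \<mu> \<mu>
    by (rule L.valuation_seminorm_field)
  interpret X: vector_space sX
    by (rule assms(5))
  interpret Y: vector_space sY
    using assms(7) by (simp add: scalar_extension_def)
  interpret field_extension_of_scalars sX sY \<iota> tensor
    using completion(3,4) assms(7) by unfold_locales
  obtain B where B: "valued_coordinates sX \<nu> B (\<lambda>b. b) (\<lambda>b x. X.representation B x b)"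
    using assms(6) X.finite_span_imp_valued_coordinates[OF _ _ assms(1)] by blast
  obtain cY where cY: "valued_coordinates sY \<mu> B (\<lambda>b. tensor 1 b) cY"
    "\<And>b x. cY b (tensor 1 x) = \<iota> (X.representation B x b)"
    using valued_coordinates_extend[OF B completion(1)] by blast
  have dense: "\<exists>k. \<mu> (\<iota> k - a) < r" if "r > 0" for a r
    using that completion(6) L.seminorm_closure_of[of a "range \<iota>"] by (auto simp: L.val_topology_eq)
  interpret completed_space sX \<nu> sY \<mu> B "\<lambda>b. b" "\<lambda>b x. X.representation B x b" "\<lambda>b. tensor 1 b" cY \<iota> tensor
  proof (intro completed_space.intro B cY(1) completed_space_axioms.intro)
    show "tensor 1 (sX k x) = sY (\<iota> k) (tensor 1 x)" for k x
      using tensor_balanced[of 1 k x] by (simp add: scale_tensor)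
  qed (use dense completion(5) tensor_add_right cY(2) assms(2,4) in auto)
  \<comment> \<open>Each subspace needs its own projection, so the locale is instantiated separately
    for every \<open>S\<close>, including the subspaces \<open>F T\<close>.\<close>
  have projection: "\<exists>P. completed_space_projection sX \<nu> sY \<mu> B (\<lambda>b. b) (\<lambda>b x. X.representation B x b)
      (\<lambda>b. tensor 1 b) cY \<iota> tensor S P" if S: "S \<in> \<sigma>" for S
  proof -
    have "Y.subspace S"
      using S by (simp add: \<sigma>_def)
    then obtain P where "Vector_Spaces.linear sY sY P" "\<And>x. P x = 0 \<longleftrightarrow> x \<in> S" "\<And>x. P (P x) = P x"
      using Y.linear_projection_along_subspace by metis
    then show ?thesis
      by (intro exI[of _ P] completed_space_projection.intro completed_space_axioms
          completed_space_projection_axioms.intro)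
  qed
  have F: "F T \<in> \<sigma>" if "T \<in> \<tau>" for T
    using subspace_F_hat that by (simp add: F_def \<sigma>_def \<tau>_def)
  moreover have "G S \<in> \<tau> \<and> F (G S) = S" if S: "S \<in> \<sigma>" for S
  proof -
    obtain P where P: "completed_space_projection sX \<nu> sY \<mu> B (\<lambda>b. b) (\<lambda>b x. X.representation B x b)
        (\<lambda>b. tensor 1 b) cY \<iota> tensor S P"
      using projection[OF S] by blast
    show ?thesis
      using completed_space_projection.G_hat_compatible[OF P] completed_space_projection.F_hat_G_hat[OF P]
      by (simp add: F_def G_def \<tau>_def)
  qed
  moreover have "G (F T) = T" if T: "T \<in> \<tau>" for T
  proof -
    obtain P where P: "completed_space_projection sX \<nu> sY \<mu> B (\<lambda>b. b) (\<lambda>b x. X.representation B x b)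
        (\<lambda>b. tensor 1 b) cY \<iota> tensor (F T) P"
      using projection[OF F[OF T]] by blast
    show ?thesis
      using completed_space_projection.G_hat_F_hat[OF P, of T] T by (simp add: F_def G_def \<tau>_def)
  qed
  moreover have "F T' \<subseteq> F T" if "topology_subset T T'" for T T'
    using F_hat_antimono[OF that] by (simp add: F_def)
  moreover have "topology_subset (G S') (G S)" if "S \<in> \<sigma>" "S' \<in> \<sigma>" "S \<subseteq> S'" for S S'
    using G_hat_antimono that by (simp add: G_def \<sigma>_def)
  ultimately show ?thesis
    by (simp add: Pi_iff)
qed

end
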